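(* There exist one-relator groups, that is, groups of the form $\mathrm{Gp}\langle A \mid w = 1\rangle$ with $A$ a finite set and $w \in (A \cup A^{-1})^*$ a single word, that have undecidable submonoid membership problem.
   Context: $\mathrm{Gp}\langle A \mid R\rangle$ denotes the group defined by generators $A$ and defining relations $R$. For a set $Y$, $Y^*$ denotes the free monoid on $Y$. Let $G$ be a group with a finite group generating set $X$, and let $\pi : (X\cup X^{-1})^* \to G$ be the canonical monoid homomorphism. The submonoid membership problem for $G$ is the decision problem: the input is a finite set of words $W = \{w_1,\dots,w_m\} \subseteq (X\cup X^{-1})^*$ and a word $w \in (X\cup X^{-1})^*$; the question is whether $\pi(w) \in \pi(W^* )$, i.e. whether the element represented by $w$ lies in the submonoid of $G$ generated by the elements represented by the words in $W$. It is undecidable if no algorithm solves it. *)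

theory Defs
  imports "HOL-Library.Nat_Bijection" "HOL-Algebra.Generated_Groups"
begin

section \<open>Words and presented groups\<close>

text \<open>The letter \<open>Inl x\<close> stands for \<open>x\<close> and \<open>Inr x\<close> for its formal inverse, so that
  \<open>A <+> A\<close> is the disjoint union of \<open>A\<close> and \<open>A\<inverse>\<close>.\<close>

type_synonym 'a word = "('a + 'a) list"

definition words :: "'a set \<Rightarrow> 'a word set" where
  "words A = lists (A <+> A)"

definition inv_letter :: "'a + 'a \<Rightarrow> 'a + 'a" where
  "inv_letter = case_sum Inr Inl"

text \<open>A defining relation \<open>u = v\<close> is given as the pair \<open>(u, v)\<close>.\<close>

inductive_set pres_cong :: "'a set \<Rightarrow> ('a word \<times> 'a word) set \<Rightarrow> ('a word \<times> 'a word) set"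
  for A :: "'a set" and R :: "('a word \<times> 'a word) set" where
  refl: "u \<in> words A \<Longrightarrow> (u, u) \<in> pres_cong A R"
| sym: "(u, v) \<in> pres_cong A R \<Longrightarrow> (v, u) \<in> pres_cong A R"
| trans: "(u, v) \<in> pres_cong A R \<Longrightarrow> (v, w) \<in> pres_cong A R \<Longrightarrow> (u, w) \<in> pres_cong A R"
| append: "(u, v) \<in> pres_cong A R \<Longrightarrow> (u', v') \<in> pres_cong A R \<Longrightarrow>
    (u @ u', v @ v') \<in> pres_cong A R"
| cancel: "l \<in> A <+> A \<Longrightarrow> ([l, inv_letter l], []) \<in> pres_cong A R"
| relation: "(u, v) \<in> R \<Longrightarrow> u \<in> words A \<Longrightarrow> v \<in> words A \<Longrightarrow> (u, v) \<in> pres_cong A R"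

definition Gp :: "'a set \<Rightarrow> ('a word \<times> 'a word) set \<Rightarrow> 'a word set monoid" where
  "Gp A R =
    \<lparr>carrier = words A // pres_cong A R,
     mult = (\<lambda>U V. \<Union>u\<in>U. \<Union>v\<in>V. pres_cong A R `` {u @ v}),
     one = pres_cong A R `` {[]}\<rparr>"

definition Gp_gen :: "'a set \<Rightarrow> ('a word \<times> 'a word) set \<Rightarrow> 'a \<Rightarrow> 'a word set" where
  "Gp_gen A R x = pres_cong A R `` {[Inl x]}"


section \<open>Computability on the natural numbers\<close>

datatype recf =
    Zero_rf
  | Succ_rf
  | Proj_rf nat
  | Comp_rf recf "recf list"
  | Primrec_rf recf recf
  | Mu_rf recf

text \<open>\<open>rec_eval f xs y\<close> means that the partial recursive function denoted by \<open>f\<close> is defined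
  on the argument tuple \<open>xs\<close>, with value \<open>y\<close>. In recursion and minimisation, the
  recursion variable and the variable searched for come first.\<close>

inductive rec_eval :: "recf \<Rightarrow> nat list \<Rightarrow> nat \<Rightarrow> bool" where
  zero: "rec_eval Zero_rf xs 0"
| succ: "rec_eval Succ_rf [x] (Suc x)"
| proj: "i < length xs \<Longrightarrow> rec_eval (Proj_rf i) xs (xs ! i)"
| comp: "length ys = length gs \<Longrightarrow> (\<And>i. i < length gs \<Longrightarrow> rec_eval (gs ! i) xs (ys ! i)) \<Longrightarrow>
    rec_eval f ys z \<Longrightarrow> rec_eval (Comp_rf f gs) xs z"
| primrec_0: "rec_eval f xs y \<Longrightarrow> rec_eval (Primrec_rf f g) (0 # xs) y"
| primrec_Suc: "rec_eval (Primrec_rf f g) (n # xs) r \<Longrightarrow> rec_eval g (n # r # xs) y \<Longrightarrow>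
    rec_eval (Primrec_rf f g) (Suc n # xs) y"
| mu: "rec_eval f (n # xs) 0 \<Longrightarrow> (\<And>m. m < n \<Longrightarrow> \<exists>k. rec_eval f (m # xs) (Suc k)) \<Longrightarrow>
    rec_eval (Mu_rf f) xs n"

text \<open>An algorithm for the problem with instances \<open>I\<close>, coded by \<open>enc\<close>, and positive
  instances \<open>P\<close> must halt with the right answer on every instance; nothing is required
  of it on numbers that are not codes of instances.\<close>

definition decidable_on :: "('i \<Rightarrow> nat) \<Rightarrow> 'i set \<Rightarrow> 'i set \<Rightarrow> bool" where
  "decidable_on enc I P \<longleftrightarrow>
    (\<exists>f. \<forall>x\<in>I. rec_eval f [enc x] (if x \<in> P then 1 else 0))"


section \<open>The submonoid membership problem\<close>

text \<open>The canonical homomorphism \<open>\<pi>\<close>, for generators of \<open>G\<close> named by symbols via \<open>\<gamma>\<close>.\<close>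

primrec word_val :: "('g, 'm) monoid_scheme \<Rightarrow> ('a \<Rightarrow> 'g) \<Rightarrow> 'a word \<Rightarrow> 'g" where
  "word_val G \<gamma> [] = \<one>\<^bsub>G\<^esub>"
| "word_val G \<gamma> (l # u) =
    (case l of Inl x \<Rightarrow> \<gamma> x | Inr x \<Rightarrow> inv\<^bsub>G\<^esub> (\<gamma> x)) \<otimes>\<^bsub>G\<^esub> word_val G \<gamma> u"

definition free_submonoid :: "'l list set \<Rightarrow> 'l list set" where
  "free_submonoid W = concat ` lists W"

text \<open>The finite set \<open>W\<close> of words is presented to the algorithm as a list \<open>ws\<close>
  of its elements.\<close>

definition smp_instances :: "'a set \<Rightarrow> ('a word list \<times> 'a word) set" where
  "smp_instances X = lists (words X) \<times> words X"

definition smp_positive ::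
    "('g, 'm) monoid_scheme \<Rightarrow> 'a set \<Rightarrow> ('a \<Rightarrow> 'g) \<Rightarrow> ('a word list \<times> 'a word) set" where
  "smp_positive G X \<gamma> =
    {(ws, w) \<in> smp_instances X.
      word_val G \<gamma> w \<in> word_val G \<gamma> ` free_submonoid (set ws)}"

definition word_encode :: "nat word \<Rightarrow> nat" where
  "word_encode u = list_encode (map sum_encode u)"

definition smp_encode :: "nat word list \<times> nat word \<Rightarrow> nat" where
  "smp_encode = (\<lambda>(ws, w). prod_encode (list_encode (map word_encode ws), word_encode w))"

definition decidable_submonoid_membership ::
    "('g, 'm) monoid_scheme \<Rightarrow> nat set \<Rightarrow> (nat \<Rightarrow> 'g) \<Rightarrow> bool" where
  "decidable_submonoid_membership G X \<gamma> \<longleftrightarrow>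
    decidable_on smp_encode (smp_instances X) (smp_positive G X \<gamma>)"


section \<open>Basic facts\<close>

lemma rec_eval_deterministic: "rec_eval f xs y \<Longrightarrow> rec_eval f xs z \<Longrightarrow> y = z"
proof (induction arbitrary: z rule: rec_eval.induct)
  case (comp ys gs xs f v)
  from comp.prems show ?case
  proof cases
    case (comp ys')
    have "ys = ys'"
      using comp(1,2) \<open>length ys = length gs\<close> comp.IH(1) by (intro nth_equalityI) auto
    then show ?thesis using comp(3) comp.IH(2) by simp
  qed
next
  case (primrec_0 f xs y g)
  from primrec_0.prems show ?case by cases (use primrec_0.IH in auto)
next
  case (primrec_Suc f g n xs r y)
  from primrec_Suc.prems show ?case by cases (use primrec_Suc.IH in blast)
next
  case (mu f n xs)
  from mu.prems show ?case
  proof cases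
    case mu2: mu
    have "\<not> z < n" using mu.IH(2)[of z] mu2(1) by blast
    moreover have "\<not> n < z" using mu2(2)[of n] mu.IH(1) by fastforce
    ultimately show ?thesis by simp
  qed
qed (auto elim: rec_eval.cases)

lemma inj_word_encode: "inj word_encode"
  by (intro injI)
    (simp add: word_encode_def list_encode_eq inj_map_eq_map[OF inj_sum_encode])

lemma inj_smp_encode: "inj smp_encode"
  by (intro injI)
    (auto simp: smp_encode_def prod_encode_eq list_encode_eq inj_eq[OF inj_word_encode]
      inj_map_eq_map[OF inj_word_encode])

lemma Nil_in_words [simp]: "[] \<in> words A"
  by (simp add: words_def)

lemma append_in_words [simp]: "u @ v \<in> words A \<longleftrightarrow> u \<in> words A \<and> v \<in> words A"
  by (auto simp: words_def)

lemma Cons_in_words [simp]: "l # u \<in> words A \<longleftrightarrow> l \<in> A <+> A \<and> u \<in> words A"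
  by (auto simp: words_def)

lemma inv_letter_in [simp]: "inv_letter l \<in> A <+> A \<longleftrightarrow> l \<in> A <+> A"
  by (cases l) (auto simp: inv_letter_def)

lemma inv_letter_invol [simp]: "inv_letter (inv_letter l) = l"
  by (cases l) (auto simp: inv_letter_def)

lemma pres_cong_in_words: "(u, v) \<in> pres_cong A R \<Longrightarrow> u \<in> words A \<and> v \<in> words A"
  by (induction rule: pres_cong.induct) auto

lemma equiv_pres_cong: "equiv (words A) (pres_cong A R)"
  unfolding equiv_def refl_on_def sym_def trans_def
  using pres_cong_in_words pres_cong.intros(1-3) by fast

lemma pres_class_eq_iff:
  assumes "u \<in> words A" "v \<in> words A"
  shows "pres_cong A R `` {u} = pres_cong A R `` {v} \<longleftrightarrow> (u, v) \<in> pres_cong A R"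
  using eq_equiv_class_iff[OF equiv_pres_cong assms] .

lemma Gp_mult_class:
  assumes "u \<in> words A" "v \<in> words A"
  shows "pres_cong A R `` {u} \<otimes>\<^bsub>Gp A R\<^esub> pres_cong A R `` {v} = pres_cong A R `` {u @ v}"
proof -
  have "congruent2 (pres_cong A R) (pres_cong A R) (\<lambda>u v. pres_cong A R `` {u @ v})"
    by (intro congruent2I' equiv_class_eq[OF equiv_pres_cong] pres_cong.append)
  from UN_equiv_class2[OF equiv_pres_cong equiv_pres_cong this assms] show ?thesis
    by (simp add: Gp_def)
qed

lemma carrier_Gp: "carrier (Gp A R) = (\<lambda>u. pres_cong A R `` {u}) ` words A"
  by (auto simp: Gp_def quotient_def)

lemma one_Gp: "\<one>\<^bsub>Gp A R\<^esub> = pres_cong A R `` {[]}"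
  by (simp add: Gp_def)

lemma pres_cong_inverse:
  assumes "u \<in> words A"
  shows "(rev (map inv_letter u) @ u, []) \<in> pres_cong A R \<and> rev (map inv_letter u) \<in> words A"
  using assms
proof (induction u)
  case Nil
  then show ?case by (auto intro: pres_cong.refl)
next
  case (Cons l u)
  let ?v = "rev (map inv_letter u)"
  have v: "?v \<in> words A" and vu: "(?v @ u, []) \<in> pres_cong A R" using Cons by auto
  have "([inv_letter l, l], []) \<in> pres_cong A R"
    using pres_cong.cancel[of "inv_letter l" A R] Cons.prems by simp
  then have "(?v @ ([inv_letter l, l] @ u), ?v @ ([] @ u)) \<in> pres_cong A R"
    using v Cons.prems by (intro pres_cong.append pres_cong.refl) auto
  then show ?case using vu v Cons.prems by (auto intro: pres_cong.trans)
qed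

theorem group_Gp: "group (Gp A R)"
proof (rule groupI)
  fix U assume "U \<in> carrier (Gp A R)"
  then obtain u where u: "u \<in> words A" "U = pres_cong A R `` {u}" by (auto simp: carrier_Gp)
  let ?v = "rev (map inv_letter u)"
  have "pres_cong A R `` {?v} \<otimes>\<^bsub>Gp A R\<^esub> U = \<one>\<^bsub>Gp A R\<^esub>"
    using pres_cong_inverse[OF u(1), of R] u
    by (simp add: Gp_mult_class one_Gp pres_class_eq_iff)
  then show "\<exists>V\<in>carrier (Gp A R). V \<otimes>\<^bsub>Gp A R\<^esub> U = \<one>\<^bsub>Gp A R\<^esub>"
    using pres_cong_inverse[OF u(1), of R] by (auto simp: carrier_Gp)
qed (auto simp: carrier_Gp one_Gp Gp_mult_class)

lemma Gp_inv_gen: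
  assumes "x \<in> A"
  shows "inv\<^bsub>Gp A R\<^esub> (Gp_gen A R x) = pres_cong A R `` {[Inr x]}"
proof -
  interpret group "Gp A R" by (rule group_Gp)
  have "([Inr x, Inl x], []) \<in> pres_cong A R"
    using pres_cong.cancel[of "Inr x" A R] assms by (simp add: inv_letter_def InrI)
  then have "pres_cong A R `` {[Inr x]} \<otimes>\<^bsub>Gp A R\<^esub> Gp_gen A R x = \<one>\<^bsub>Gp A R\<^esub>"
    using assms by (simp add: Gp_gen_def Gp_mult_class one_Gp pres_class_eq_iff InlI InrI)
  then show ?thesis
    using assms by (intro inv_equality) (auto simp: carrier_Gp Gp_gen_def)
qed

lemma word_val_Gp:
  "u \<in> words A \<Longrightarrow> word_val (Gp A R) (Gp_gen A R) u = pres_cong A R `` {u}"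
proof (induction u)
  case (Cons l u)
  have "(case l of Inl x \<Rightarrow> Gp_gen A R x | Inr x \<Rightarrow> inv\<^bsub>Gp A R\<^esub> (Gp_gen A R x))
      = pres_cong A R `` {[l]}"
    using Cons.prems by (auto simp: Gp_inv_gen Gp_gen_def[symmetric] split: sum.split)
  then show ?case
    using Cons by (simp add: Gp_mult_class)
qed (simp add: one_Gp)

lemma word_val_in_generate:
  "u \<in> words A \<Longrightarrow> word_val G \<gamma> u \<in> generate G (\<gamma> ` A)"
  by (induction u) (auto intro: generate.intros split: sum.split)

lemma generate_Gp: "generate (Gp A R) (Gp_gen A R ` A) = carrier (Gp A R)"
proof
  interpret group "Gp A R" by (rule group_Gp)
  show "generate (Gp A R) (Gp_gen A R ` A) \<subseteq> carrier (Gp A R)"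
    by (rule generate_incl) (auto simp: carrier_Gp Gp_gen_def)
  show "carrier (Gp A R) \<subseteq> generate (Gp A R) (Gp_gen A R ` A)"
    using word_val_in_generate[of _ A "Gp A R" "Gp_gen A R"] by (auto simp: carrier_Gp word_val_Gp)
qed

lemma (in group) word_val_closed:
  "\<gamma> ` A \<subseteq> carrier G \<Longrightarrow> u \<in> words A \<Longrightarrow> word_val G \<gamma> u \<in> carrier G"
  by (rule generate_in_carrier[OF _ word_val_in_generate])

lemma (in group) word_val_append:
  assumes "\<gamma> ` A \<subseteq> carrier G" "u \<in> words A" "v \<in> words A"
  shows "word_val G \<gamma> (u @ v) = word_val G \<gamma> u \<otimes> word_val G \<gamma> v"
  using assms(2)
proof (induction u)
  case (Cons l u)
  have "(case l of Inl x \<Rightarrow> \<gamma> x | Inr x \<Rightarrow> inv (\<gamma> x)) \<in> carrier G"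
    using Cons.prems assms(1) by (auto split: sum.split)
  then show ?case
    using Cons word_val_closed[OF assms(1)] assms(3) by (simp add: m_assoc)
qed (use word_val_closed[OF assms(1) assms(3)] in simp)

text \<open>Universal property: words congruent in the presentation have equal value in every
  group in which the defining relations hold.\<close>

lemma (in group) word_val_pres_cong:
  assumes "\<gamma> ` A \<subseteq> carrier G"
    and "\<And>u v. (u, v) \<in> R \<Longrightarrow> u \<in> words A \<Longrightarrow> v \<in> words A \<Longrightarrow> word_val G \<gamma> u = word_val G \<gamma> v"
    and "(u, v) \<in> pres_cong A R"
  shows "word_val G \<gamma> u = word_val G \<gamma> v"
  using assms(3)
proof (induction rule: pres_cong.induct)
  case (append u v u' v')
  then show ?case using word_val_append[OF assms(1)] by (metis pres_cong_in_words)
next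
  case (cancel l)
  then show ?case using assms(1) by (cases l) (auto simp: inv_letter_def image_subset_iff)
next
  case (relation u v)
  then show ?case by (rule assms(2))
qed auto

end

theory Submission
  imports Defs "HOL-Library.Countable" "HOL-Computational_Algebra.Primes" Complex_Main
begin

text \<open>
  The group is the one with generators \<open>a, t\<close> and the single relation that \<open>a\<close> commutes with \<open>t a t\<inverse>\<close>. Its
  elements \<open>t\<^sup>i a t\<^sup>-\<^sup>i\<close>, for integers \<open>i\<close>, form a line on which neighbours commute (\<open>line_commute\<close>). Let
  \<open>a, b, c, d\<close> now denote four consecutive ones, so that neighbours in this list commute.

  Computations are represented as sequences of numbers \<open>n\<^sub>0, n\<^sub>1, \<dots>\<close> in which each number arises from its
  predecessor by a step \<open>p * j + r \<mapsto> q * j + s\<close>. The word \<open>(b c)\<^bsup>n\<^sub>0\<^esup> d a (b c)\<^bsup>n\<^sub>1\<^esup> d a \<dots>\<close> can be rearranged, by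
  moving letters \<open>c\<close> past \<open>d\<close> and letters \<open>b\<close> past \<open>a\<close>, into the word that begins with \<open>b\<^bsup>n\<^sub>0\<^esup> d\<close> and goes on with
  \<open>c\<^bsup>n\<^sub>0\<^esup> b\<^bsup>n\<^sub>1\<^esup> a d\<close>, \<open>c\<^bsup>n\<^sub>1\<^esup> b\<^bsup>n\<^sub>2\<^esup> a d\<close> and so on (\<open>step_identity\<close>). The first form forces the two copies of
  each number to be equal; in the second form a finite automaton can check that each step is allowed. So an automaton
  that first writes an arbitrary word of the first form and then inverses of blocks of the second form
  can produce \<open>b\<^sup>N d\<close> iff there is a computation that starts at \<open>N\<close> and ends with \<open>0\<close> when the
  program is finished.

  An automaton with labels in the group is replaced by a submonoid: for each state \<open>p\<close> there is a letter \<open>s\<^sub>p\<close> of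
  the line, far away from the other letters, and an edge from \<open>p\<close> to \<open>q\<close> with label \<open>g\<close> gives the generator
  \<open>s\<^sub>p g s\<^sub>q\<inverse>\<close> (\<open>run_imp_product\<close>). For the converse directions two actions of the group are combined. One
  recovers from a product of generators a run of the automaton (\<open>product_imp_run\<close>). In the other one, \<open>b, d\<close>
  and \<open>c, a\<close> push digits to two stacks, and the contents of the stacks determine the computation
  (\<open>run_from_Guess\<close>). Together this gives \<open>query_in_submonoid_iff\<close>.

  Every partial recursive function is computed by such steps under the control of a regular program, if the
  contents of registers are encoded as exponents of primes in a single number (\<open>all_programmable\<close>). The set of
  generators of the submonoid belongs to the input of the decision problem, so a direct diagonalization
  (\<open>undecidable_membership\<close>) finishes the proof.
\<close>

section \<open>Programs that rewrite a single number\<close>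

text \<open>The primitive step \<open>p * j + r \<mapsto> q * j + s\<close>, with \<open>j\<close> arbitrary, is what an automaton over
  two commuting letters can check with one loop. It covers multiplication, exact division and tests
  on residues. The other constructors are those of regular expressions, so that a program is already
  the description of an automaton.\<close>

datatype prog = Lin nat nat nat nat | Seq prog prog | Alt prog prog | Iter prog

primrec sem :: "prog \<Rightarrow> (nat \<times> nat) set" where
  "sem (Lin p r q s) = {(p * j + r, q * j + s) | j. True}"
| "sem (Seq e1 e2) = sem e1 O sem e2"
| "sem (Alt e1 e2) = sem e1 \<union> sem e2"
| "sem (Iter e) = (sem e)\<^sup>*"

lemma sem_Seq: "(n, n') \<in> sem (Seq e1 e2) \<longleftrightarrow> (\<exists>z. (n, z) \<in> sem e1 \<and> (z, n') \<in> sem e2)"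
  by auto

lemma ex_image_iff: "(\<exists>z. (\<exists>y. P y \<and> z = h y) \<and> Q z) \<longleftrightarrow> (\<exists>y. P y \<and> Q (h y))"
  by blast

lemma sem_scale: "(n, n') \<in> sem (Lin p 0 q 0) \<longleftrightarrow> (\<exists>j. n = p * j \<and> n' = q * j)"
  by auto

definition mul :: "nat \<Rightarrow> prog" where
  "mul q = Lin 1 0 q 0"

lemma sem_mul [simp]: "(n, n') \<in> sem (mul q) \<longleftrightarrow> n' = n * q"
  by (auto simp: mul_def mult.commute)

lemma sem_empty: "n > 0 \<Longrightarrow> (n, n') \<notin> sem (Lin 0 0 0 0)"
  by auto

text \<open>There is no negative test among the primitive steps; not being divisible by \<open>p\<close> is having one of
  the finitely many nonzero residues. On \<open>0\<close> the starting value \<open>Lin 0 0 0 0\<close> would succeed, so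
  the test is meant for positive numbers, where that step is never applicable.\<close>

definition not_dvd_test :: "nat \<Rightarrow> prog" where
  "not_dvd_test p = fold (\<lambda>r. Alt (Lin p r p r)) [1..<p] (Lin 0 0 0 0)"

lemma sem_not_dvd_test:
  assumes "n > 0" "p > 0"
  shows "(n, n') \<in> sem (not_dvd_test p) \<longleftrightarrow> n' = n \<and> \<not> p dvd n"
proof -
  have fold: "sem (fold (\<lambda>r. Alt (Lin p r p r)) rs e) = (\<Union>r\<in>set rs. sem (Lin p r p r)) \<union> sem e"
    for rs e by (induction rs arbitrary: e) auto
  have "(n, n') \<in> sem (not_dvd_test p) \<longleftrightarrow>
      (\<exists>r\<in>{1..<p}. \<exists>j. n = p * j + r \<and> n' = n)"
    using assms unfolding not_dvd_test_def fold by auto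
  also have "\<dots> \<longleftrightarrow> (\<exists>r j. 1 \<le> r \<and> r < p \<and> n = p * j + r \<and> n' = n)"
    by auto
  also have "\<dots> \<longleftrightarrow> n' = n \<and> \<not> p dvd n"
  proof
    assume "n' = n \<and> \<not> p dvd n"
    then have "1 \<le> n mod p" "n mod p < p" "n = p * (n div p) + n mod p"
      using assms by (auto simp: dvd_eq_mod_eq_0 Suc_le_eq)
    then show "\<exists>r j. 1 \<le> r \<and> r < p \<and> n = p * j + r \<and> n' = n"
      using \<open>n' = n \<and> \<not> p dvd n\<close> by blast
  qed (auto simp: dvd_eq_mod_eq_0)
  finally show ?thesis .
qed

text \<open>If registers are prime exponents, this loop empties the register \<open>p\<close> while adding its contents
  to every register that is a factor of \<open>q\<close>; with \<open>q = 1\<close> it just clears \<open>p\<close>. The final test makes the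
  loop run to the end.\<close>

definition transfer :: "nat \<Rightarrow> nat \<Rightarrow> prog" where
  "transfer p q = Seq (Iter (Lin p 0 q 0)) (not_dvd_test p)"

lemma sem_transfer:
  assumes p: "prime p" and q: "q > 0" "\<not> p dvd q" and m: "\<not> p dvd m"
  shows "(m * p ^ k, n') \<in> sem (transfer p q) \<longleftrightarrow> n' = m * q ^ k"
  using m
proof (induction k arbitrary: m)
  case 0
  have pos: "m > 0" using 0 by (auto intro: Nat.gr0I)
  have "(m, z) \<in> (sem (Lin p 0 q 0))\<^sup>* \<longleftrightarrow> z = m" for z
  proof
    assume "(m, z) \<in> (sem (Lin p 0 q 0))\<^sup>*"
    then show "z = m" using 0 by (cases rule: converse_rtranclE) (auto simp: sem_scale)
  qed simp
  then show ?case
    using sem_not_dvd_test[OF pos prime_gt_0_nat[OF p]] 0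
    by (auto simp: transfer_def relcomp_unfold simp del: sem.simps(1))
next
  case (Suc k)
  have pos: "m > 0" using Suc.prems by (auto intro: Nat.gr0I)
  have nd: "\<not> p dvd m * q" using Suc.prems q p by (simp add: prime_dvd_mult_iff)
  have step: "(m * p ^ Suc k, z) \<in> sem (Lin p 0 q 0) \<longleftrightarrow> z = m * q * p ^ k" for z
    using prime_gt_0_nat[OF p] by (auto simp: sem_scale)
  have dv: "p dvd m * p ^ Suc k" by simp
  have "(m * p ^ Suc k, n') \<in> sem (transfer p q) \<longleftrightarrow> (m * q * p ^ k, n') \<in> sem (transfer p q)"
  proof
    assume "(m * p ^ Suc k, n') \<in> sem (transfer p q)"
    then obtain z where z: "(m * p ^ Suc k, z) \<in> (sem (Lin p 0 q 0))\<^sup>*"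
      "(z, n') \<in> sem (not_dvd_test p)" by (auto simp: transfer_def simp del: sem.simps(1))
    have "z \<noteq> m * p ^ Suc k"
      using z(2) sem_not_dvd_test[of "m * p ^ Suc k" p] pos prime_gt_0_nat[OF p] dv by auto
    with z(1) have "(m * q * p ^ k, z) \<in> (sem (Lin p 0 q 0))\<^sup>*"
      by (metis converse_rtranclE step)
    with z(2) show "(m * q * p ^ k, n') \<in> sem (transfer p q)"
      by (auto simp: transfer_def simp del: sem.simps(1))
  next
    assume "(m * q * p ^ k, n') \<in> sem (transfer p q)"
    then show "(m * p ^ Suc k, n') \<in> sem (transfer p q)"
      using step by (auto simp: transfer_def simp del: sem.simps(1) intro: converse_rtrancl_into_rtrancl)
  qed
  then show ?case using Suc.IH[OF nd] by (simp add: algebra_simps)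
qed

section \<open>Recursive functions as programs with prime exponents for registers\<close>

abbreviation vals :: "nat list \<Rightarrow> nat \<Rightarrow> nat list" where
  "vals rs n \<equiv> map (\<lambda>p. multiplicity p n) rs"

lemma multiplicity_times_other_prime:
  assumes "prime (p::nat)" "prime q" "p \<noteq> q" "n > 0"
  shows "multiplicity p (n * q ^ y) = multiplicity p n"
  using assms
  by (subst prime_elem_multiplicity_mult_distrib)
    (auto simp: multiplicity_distinct_prime_power)

lemma multiplicity_times_same_prime:
  assumes "prime (p::nat)" "n > 0"
  shows "multiplicity p (n * p ^ y) = multiplicity p n + y"
  using assms by (subst prime_elem_multiplicity_mult_distrib) (auto simp: multiplicity_same_power)

lemma vals_times_prime:
  assumes "\<forall>p\<in>set rs. prime p" "prime q" "q \<notin> set rs" "n > 0"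
  shows "vals rs (n * q ^ y) = vals rs n"
  using assms by (auto intro!: multiplicity_times_other_prime)

lemma prime_not_dvd_times:
  assumes "prime (p::nat)" "prime q" "p \<noteq> q"
  shows "p dvd n * q ^ y \<longleftrightarrow> p dvd n"
  using assms by (auto simp: prime_dvd_mult_iff dest: prime_dvd_power primes_dvd_imp_eq)

text \<open>Emptying \<open>p\<close> into \<open>q\<close> and an auxiliary register \<open>t\<close> at the same time, and then moving \<open>t\<close>
  back, leaves \<open>p\<close> as it was.\<close>

definition copy :: "nat \<Rightarrow> nat \<Rightarrow> nat \<Rightarrow> prog" where
  "copy p q t = Seq (transfer p (t * q)) (transfer t p)"

lemma sem_copy:
  assumes "prime p" "prime q" "prime t" "p \<noteq> q" "p \<noteq> t" "q \<noteq> t" "n > 0" "\<not> t dvd n"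
  shows "(n, n') \<in> sem (copy p q t) \<longleftrightarrow> n' = n * q ^ multiplicity p n"
proof -
  obtain m where m: "n = m * p ^ multiplicity p n" "\<not> p dvd m"
    using multiplicity_decompose'[of n p] assms by (metis mult.commute not_prime_unit less_irrefl)
  define k where "k = multiplicity p n"
  have "\<not> t dvd m" using m(1) assms(8) by (metis dvd_mult2)
  then have td: "\<not> t dvd m * q ^ k" using prime_not_dvd_times assms by metis
  have pd: "\<not> p dvd t * q" "\<not> t dvd p"
    using assms by (auto simp: prime_dvd_mult_iff dest: primes_dvd_imp_eq)
  have pos: "t * q > 0" "p > 0" using assms prime_gt_0_nat by auto
  have e: "m * (t * q) ^ k = m * q ^ k * t ^ k" by (simp add: power_mult_distrib)
  have "(n, z) \<in> sem (transfer p (t * q)) \<longleftrightarrow> z = m * q ^ k * t ^ k" for z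
    using sem_transfer[OF assms(1) pos(1) pd(1) m(2), of k z] m(1) e unfolding k_def by metis
  moreover have "(m * q ^ k * t ^ k, n') \<in> sem (transfer t p) \<longleftrightarrow> n' = m * q ^ k * p ^ k"
    using sem_transfer[OF assms(3) pos(2) pd(2) td] .
  ultimately have "(n, n') \<in> sem (copy p q t) \<longleftrightarrow> n' = m * q ^ k * p ^ k"
    by (auto simp: copy_def)
  moreover have "m * q ^ k * p ^ k = n * q ^ multiplicity p n"
    using m(1) unfolding k_def[symmetric] by (simp only: mult_ac)
  ultimately show ?thesis by simp
qed

text \<open>The result is added to the output register \<open>q\<close> and every other register, in particular every
  work register in \<open>W\<close>, is as before. This makes the specification compose: programs can be chained
  as long as each finds its own work registers empty.\<close>

definition computes :: "prog \<Rightarrow> recf \<Rightarrow> nat list \<Rightarrow> nat \<Rightarrow> nat set \<Rightarrow> bool" where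
  "computes e f rs q W \<longleftrightarrow> (\<forall>n>0. (\<forall>p\<in>W. \<not> p dvd n) \<longrightarrow> (\<forall>n'.
     (n, n') \<in> sem e \<longleftrightarrow> (\<exists>y. rec_eval f (vals rs n) y \<and> n' = n * q ^ y)))"

lemma computesD:
  assumes "computes e f rs q W" "n > 0" "\<And>p. p \<in> W \<Longrightarrow> \<not> p dvd n" "vals rs n = xs"
  shows "(n, n') \<in> sem e \<longleftrightarrow> (\<exists>y. rec_eval f xs y \<and> n' = n * q ^ y)"
  using assms unfolding computes_def by blast

text \<open>The work registers can be kept away from any finite set \<open>V\<close> of registers in use; this is what
  lets the programs of subterms be combined.\<close>

definition programmable :: "recf \<Rightarrow> bool" where
  "programmable f \<longleftrightarrow> (\<forall>rs q V. finite V \<and> set rs \<subseteq> V \<and> q \<in> V \<and> q \<notin> set rs \<and> (\<forall>p\<in>V. prime p) \<longrightarrow>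
     (\<exists>e W. finite W \<and> (\<forall>p\<in>W. prime p) \<and> W \<inter> V = {} \<and> computes e f rs q W))"

lemma programmableE:
  assumes "programmable f" "finite V" "set rs \<subseteq> V" "q \<in> V" "q \<notin> set rs" "\<forall>p\<in>V. prime p"
  obtains e W where "finite W" "\<forall>p\<in>W. prime p" "W \<inter> V = {}" "computes e f rs q W"
  using assms unfolding programmable_def by meson

lemma fresh_prime:
  assumes "finite (V :: nat set)"
  obtains p where "prime p" "p \<notin> V"
proof -
  have "infinite {p::nat. prime p}" by (rule primes_infinite)
  then have "\<not> {p. prime p} \<subseteq> V" using assms finite_subset by blast
  then show ?thesis using that by blast
qed

lemma fresh_primes:
  assumes "finite (V :: nat set)"
  obtains ts where "length ts = k" "distinct ts" "\<forall>t\<in>set ts. prime t" "set ts \<inter> V = {}"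
proof -
  have "\<exists>ts. length ts = k \<and> distinct ts \<and> (\<forall>t\<in>set ts. prime t) \<and> set ts \<inter> V = {}"
  proof (induction k)
    case (Suc k)
    then obtain ts where ts: "length ts = k" "distinct ts" "\<forall>t\<in>set ts. prime t" "set ts \<inter> V = {}"
      by blast
    obtain p where "prime p" "p \<notin> V \<union> set ts" using fresh_prime[of "V \<union> set ts"] assms by auto
    then show ?case using ts by (intro exI[of _ "p # ts"]) auto
  qed simp
  then show ?thesis using that by blast
qed

lemma programmable_Zero: "programmable Zero_rf"
proof -
  have [simp]: "rec_eval Zero_rf xs y \<longleftrightarrow> y = 0" for xs y
    by (auto intro: rec_eval.zero elim: rec_eval.cases)
  have "computes (mul 1) Zero_rf rs q {}" for rs q
    unfolding computes_def by simp
  then show ?thesis unfolding programmable_def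
    by (intro allI impI exI[of _ "mul 1"] exI[of _ "{}"]) simp
qed

text \<open>The step \<open>Lin 0 0 0 0\<close> only relates \<open>0\<close> to \<open>0\<close>, so on positive numbers it is a program without
  any outcome.\<close>

lemma computes_undefined:
  assumes "\<And>n y. \<not> rec_eval f (vals rs n) y"
  shows "computes (Lin 0 0 0 0) f rs q {}"
  using assms sem_empty unfolding computes_def by blast

lemma programmable_Proj: "programmable (Proj_rf i)"
  unfolding programmable_def
proof (intro allI impI, elim conjE)
  fix rs :: "nat list" and q :: nat and V :: "nat set"
  assume V: "finite V" "set rs \<subseteq> V" "q \<in> V" "q \<notin> set rs" "\<forall>p\<in>V. prime p"
  have ev: "rec_eval (Proj_rf i) xs y \<longleftrightarrow> i < length xs \<and> y = xs ! i" for xs y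
    by (auto intro: rec_eval.proj elim: rec_eval.cases)
  show "\<exists>e W. finite W \<and> (\<forall>p\<in>W. prime p) \<and> W \<inter> V = {} \<and> computes e (Proj_rf i) rs q W"
  proof (cases "i < length rs")
    case True
    obtain t where t: "prime t" "t \<notin> V" using fresh_prime[OF V(1)] .
    have "rs ! i \<in> V" "rs ! i \<noteq> q" using True V by auto
    then have "computes (copy (rs ! i) q t) (Proj_rf i) rs q {t}"
      unfolding computes_def ev using sem_copy[of "rs ! i" q t] V t True by auto
    then show ?thesis using t by (intro exI[of _ "copy (rs ! i) q t"] exI[of _ "{t}"]) auto
  next
    case False
    then have "computes (Lin 0 0 0 0) (Proj_rf i) rs q {}" by (intro computes_undefined) (simp add: ev)
    then show ?thesis by (intro exI[of _ "Lin 0 0 0 0"] exI[of _ "{}"]) auto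
  qed
qed

lemma programmable_Succ: "programmable Succ_rf"
  unfolding programmable_def
proof (intro allI impI, elim conjE)
  fix rs :: "nat list" and q :: nat and V :: "nat set"
  assume V: "finite V" "set rs \<subseteq> V" "q \<in> V" "q \<notin> set rs" "\<forall>p\<in>V. prime p"
  have ev: "rec_eval Succ_rf xs y \<longleftrightarrow> (\<exists>x. xs = [x] \<and> y = Suc x)" for xs y
    by (auto intro: rec_eval.succ elim: rec_eval.cases)
  show "\<exists>e W. finite W \<and> (\<forall>p\<in>W. prime p) \<and> W \<inter> V = {} \<and> computes e Succ_rf rs q W"
  proof (cases "\<exists>r. rs = [r]")
    case True
    then obtain r where r: "rs = [r]" by blast
    obtain t where t: "prime t" "t \<notin> V" using fresh_prime[OF V(1)] .
    have ne: "r \<noteq> t" "q \<noteq> t" "r \<noteq> q" "prime r" "prime q" using V t r by auto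
    have "computes (Seq (copy r q t) (mul q)) Succ_rf rs q {t}"
      unfolding computes_def ev sem.simps(2) relcomp_unfold
      using sem_copy[OF ne(4,5) t(1) ne(3,1,2)] unfolding sem_mul by (simp add: r mult_ac)
    then show ?thesis using t
      by (intro exI[of _ "Seq (copy r q t) (mul q)"] exI[of _ "{t}"]) auto
  next
    case False
    then have "computes (Lin 0 0 0 0) Succ_rf rs q {}" by (intro computes_undefined) (auto simp: ev)
    then show ?thesis by (intro exI[of _ "Lin 0 0 0 0"] exI[of _ "{}"]) auto
  qed
qed

text \<open>The contribution of registers \<open>ts\<close> with contents \<open>ys\<close> to the encoding. Recursion is on the registers
  only, with \<open>hd\<close> and \<open>tl\<close> on the contents, so that no side condition on lengths is needed to unfold it.\<close>

primrec pow_prod :: "nat list \<Rightarrow> nat list \<Rightarrow> nat" where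
  "pow_prod [] ys = 1"
| "pow_prod (t # ts) ys = t ^ hd ys * pow_prod ts (tl ys)"

lemma prime_dvd_pow_prod:
  assumes "prime p" "p \<notin> set ts" "\<forall>t\<in>set ts. prime t"
  shows "p dvd n * pow_prod ts ys \<longleftrightarrow> p dvd n"
  using assms(2,3)
proof (induction ts arbitrary: n ys)
  case (Cons t ts)
  have "p dvd n * pow_prod (t # ts) ys \<longleftrightarrow> p dvd (n * t ^ hd ys) * pow_prod ts (tl ys)"
    by (simp add: mult.assoc)
  also have "\<dots> \<longleftrightarrow> p dvd n * t ^ hd ys" using Cons.prems by (intro Cons.IH) auto
  also have "\<dots> \<longleftrightarrow> p dvd n" using Cons.prems assms(1) by (intro prime_not_dvd_times) auto
  finally show ?case .
qed simp

lemma pow_prod_pos: "\<forall>t\<in>set ts. prime t \<Longrightarrow> pow_prod ts ys > 0"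
  by (induction ts arbitrary: ys) (auto simp: prime_gt_0_nat)

lemma multiplicity_pow_prod_other:
  assumes "prime p" "p \<notin> set ts" "\<forall>t\<in>set ts. prime t" "n > 0"
  shows "multiplicity p (n * pow_prod ts ys) = multiplicity p n"
proof -
  have "\<not> p dvd 1 * pow_prod ts ys" using prime_dvd_pow_prod[OF assms(1-3), of 1] assms(1)
    using not_prime_unit by blast
  then show ?thesis using assms(1,4) pow_prod_pos[OF assms(3), of ys]
    by (subst prime_elem_multiplicity_mult_distrib) (auto simp: not_dvd_imp_multiplicity_0)
qed

lemma vals_pow_prod:
  assumes "distinct ts" "\<forall>t\<in>set ts. prime t" "n > 0" "\<forall>t\<in>set ts. \<not> t dvd n"
    "length ys = length ts"
  shows "vals ts (n * pow_prod ts ys) = ys"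
  using assms
proof (induction ts arbitrary: n ys)
  case (Cons t ts)
  then obtain y ys' where ys: "ys = y # ys'" by (cases ys) auto
  have t: "prime t" "t \<notin> set ts" using Cons.prems by auto
  have pos: "n * t ^ y > 0" using Cons.prems t prime_gt_0_nat by auto
  have eq: "n * pow_prod (t # ts) ys = (n * t ^ y) * pow_prod ts ys'" by (simp add: ys mult.assoc)
  have "vals ts ((n * t ^ y) * pow_prod ts ys') = ys'"
  proof (rule Cons.IH)
    show "\<forall>u\<in>set ts. \<not> u dvd n * t ^ y"
    proof
      fix u assume "u \<in> set ts"
      then show "\<not> u dvd n * t ^ y" using prime_not_dvd_times[of u t n y] Cons.prems t by auto
    qed
  qed (use Cons.prems pos ys in auto)
  moreover have "multiplicity t ((n * t ^ y) * pow_prod ts ys') = y"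
    using t Cons.prems pos
    by (simp add: multiplicity_pow_prod_other multiplicity_times_same_prime not_dvd_imp_multiplicity_0)
  ultimately show ?case unfolding eq by (simp add: ys)
qed simp

definition computes_list :: "prog \<Rightarrow> recf list \<Rightarrow> nat list \<Rightarrow> nat list \<Rightarrow> nat set \<Rightarrow> bool" where
  "computes_list e gs rs ts W \<longleftrightarrow> (\<forall>n>0. (\<forall>p\<in>W. \<not> p dvd n) \<longrightarrow> (\<forall>n'. (n, n') \<in> sem e \<longleftrightarrow>
      (\<exists>ys. list_all2 (\<lambda>g y. rec_eval g (vals rs n) y) gs ys \<and> n' = n * pow_prod ts ys)))"

lemma computes_listD:
  assumes "computes_list e gs rs ts W" "n > 0" "\<And>p. p \<in> W \<Longrightarrow> \<not> p dvd n" "vals rs n = xs"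
  shows "(n, n') \<in> sem e \<longleftrightarrow>
    (\<exists>ys. list_all2 (\<lambda>g y. rec_eval g xs y) gs ys \<and> n' = n * pow_prod ts ys)"
  using assms unfolding computes_list_def by blast

lemma programs_for_list:
  assumes "\<forall>g\<in>set gs. programmable g"
    "finite V" "set rs \<subseteq> V" "set ts \<subseteq> V" "set ts \<inter> set rs = {}" "\<forall>p\<in>V. prime p"
    "length ts = length gs"
  shows "\<exists>e W. finite W \<and> (\<forall>p\<in>W. prime p) \<and> W \<inter> V = {} \<and> computes_list e gs rs ts W"
  using assms(1,4,5,7)
proof (induction gs arbitrary: ts)
  case Nil
  then have "computes_list (mul 1) [] rs ts {}" unfolding computes_list_def by simp
  then show ?case by (intro exI[of _ "mul 1"] exI[of _ "{}"]) simp
next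
  case (Cons g gs)
  then obtain t ts' where ts: "ts = t # ts'" by (cases ts) auto
  obtain e W where W: "finite W" "\<forall>p\<in>W. prime p" "W \<inter> V = {}" "computes_list e gs rs ts' W"
    using Cons.IH[of ts'] Cons.prems ts by auto
  have t: "t \<in> V" "t \<notin> set rs" "prime t" using ts Cons.prems assms(6) by auto
  have g: "programmable g" using Cons.prems(1) by simp
  obtain e0 W0 where W0: "finite W0" "\<forall>p\<in>W0. prime p" "W0 \<inter> V = {}" "computes e0 g rs t W0"
    using programmableE[OF g assms(2,3) t(1,2) assms(6)] .
  have "(n, n') \<in> sem (Seq e0 e) \<longleftrightarrow>
      (\<exists>ys. list_all2 (\<lambda>g y. rec_eval g (vals rs n) y) (g # gs) ys \<and> n' = n * pow_prod ts ys)"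
    if n: "n > 0" "\<forall>p\<in>W0 \<union> W. \<not> p dvd n" for n n'
  proof -
    have 1: "(n, z) \<in> sem e0 \<longleftrightarrow> (\<exists>y. rec_eval g (vals rs n) y \<and> z = n * t ^ y)" for z
      using computesD[OF W0(4) n(1)] n(2) by blast
    have 2: "(n * t ^ y, n') \<in> sem e \<longleftrightarrow>
      (\<exists>ys. list_all2 (\<lambda>g y. rec_eval g (vals rs n) y) gs ys \<and> n' = n * t ^ y * pow_prod ts' ys)" for y
    proof -
      have "vals rs (n * t ^ y) = vals rs n"
        using assms(3,6) by (intro vals_times_prime t n(1)) auto
      moreover have "\<forall>p\<in>W. \<not> p dvd n * t ^ y"
      proof
        fix p assume "p \<in> W"
        then show "\<not> p dvd n * t ^ y" using prime_not_dvd_times[of p t n y] W(2,3) t n(2) by auto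
      qed
      ultimately show ?thesis
        using computes_listD[OF W(4), of "n * t ^ y" "vals rs n" n'] n t(3) prime_gt_0_nat by simp
    qed
    have "(n, n') \<in> sem (Seq e0 e) \<longleftrightarrow> (\<exists>y ys. rec_eval g (vals rs n) y \<and>
        list_all2 (\<lambda>g y. rec_eval g (vals rs n) y) gs ys \<and> n' = n * t ^ y * pow_prod ts' ys)"
      unfolding sem_Seq 1 ex_image_iff 2 by blast
    also have "\<dots> \<longleftrightarrow>
      (\<exists>ys. list_all2 (\<lambda>g y. rec_eval g (vals rs n) y) (g # gs) ys \<and> n' = n * pow_prod ts ys)"
      (is "?L \<longleftrightarrow> ?R")
    proof
      assume ?L
      then obtain y ys where "rec_eval g (vals rs n) y"
        "list_all2 (\<lambda>g y. rec_eval g (vals rs n) y) gs ys" "n' = n * t ^ y * pow_prod ts' ys"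
        by (elim exE conjE)
      then show ?R by (intro exI[of _ "y # ys"]) (simp add: ts mult.assoc)
    next
      assume ?R
      then obtain y ys where "rec_eval g (vals rs n) y"
        "list_all2 (\<lambda>g y. rec_eval g (vals rs n) y) gs ys" "n' = n * pow_prod ts (y # ys)"
        unfolding list_all2_Cons1 by (elim exE conjE) simp
      then show ?L by (intro exI[of _ y] exI[of _ ys]) (simp add: ts mult.assoc)
    qed
    finally show ?thesis .
  qed
  then have "computes_list (Seq e0 e) (g # gs) rs ts (W0 \<union> W)"
    unfolding computes_list_def by blast
  then show ?case using W W0
    by (intro exI[of _ "Seq e0 e"] exI[of _ "W0 \<union> W"]) auto
qed

primrec clear :: "nat list \<Rightarrow> prog" where
  "clear [] = mul 1"
| "clear (t # ts) = Seq (transfer t 1) (clear ts)"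

lemma sem_clear:
  assumes "distinct ts" "\<forall>t\<in>set ts. prime t" "\<forall>t\<in>set ts. \<not> t dvd n"
  shows "(n * pow_prod ts ys, n') \<in> sem (clear ts) \<longleftrightarrow> n' = n"
  using assms
proof (induction ts arbitrary: n ys)
  case Nil
  then show ?case by simp
next
  case (Cons t ts)
  have t: "prime t" "t \<notin> set ts" using Cons.prems by auto
  have nd: "\<not> t dvd n * pow_prod ts (tl ys)" using prime_dvd_pow_prod[OF t] Cons.prems by auto
  have eq: "n * pow_prod (t # ts) ys = (n * pow_prod ts (tl ys)) * t ^ hd ys" by simp
  have "(n * pow_prod (t # ts) ys, z) \<in> sem (transfer t 1) \<longleftrightarrow> z = n * pow_prod ts (tl ys)" for z
    using sem_transfer[OF t(1) _ _ nd, of 1 "hd ys" z] not_prime_unit[of t] t(1) unfolding eq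
    by (cases "t = 1") auto
  then show ?case using Cons by (auto simp: relcomp_unfold simp del: pow_prod.simps)
qed

lemma programmable_Comp:
  assumes f: "programmable f" and gs: "\<forall>g\<in>set gs. programmable g"
  shows "programmable (Comp_rf f gs)"
  unfolding programmable_def
proof (intro allI impI, elim conjE)
  fix rs :: "nat list" and q :: nat and V :: "nat set"
  assume V: "finite V" "set rs \<subseteq> V" "q \<in> V" "q \<notin> set rs" "\<forall>p\<in>V. prime p"
  have ev: "rec_eval (Comp_rf f gs) xs z \<longleftrightarrow>
      (\<exists>ys. list_all2 (\<lambda>g y. rec_eval g xs y) gs ys \<and> rec_eval f ys z)" for xs z
  proof
    assume "rec_eval (Comp_rf f gs) xs z"
    then show "\<exists>ys. list_all2 (\<lambda>g y. rec_eval g xs y) gs ys \<and> rec_eval f ys z"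
      by cases (force simp: list_all2_conv_all_nth)
  next
    assume "\<exists>ys. list_all2 (\<lambda>g y. rec_eval g xs y) gs ys \<and> rec_eval f ys z"
    then show "rec_eval (Comp_rf f gs) xs z"
      by (auto simp: list_all2_conv_all_nth intro: rec_eval.comp)
  qed
  obtain ts where ts: "length ts = length gs" "distinct ts" "\<forall>t\<in>set ts. prime t" "set ts \<inter> V = {}"
    using fresh_primes[OF V(1)] .
  let ?V = "V \<union> set ts"
  have V': "finite ?V" "set rs \<subseteq> ?V" "set ts \<subseteq> ?V" "set ts \<inter> set rs = {}" "\<forall>p\<in>?V. prime p"
    "q \<in> ?V" "q \<notin> set ts"
    using V ts by auto
  obtain e1 W1 where W1: "finite W1" "\<forall>p\<in>W1. prime p" "W1 \<inter> ?V = {}"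
      "computes_list e1 gs rs ts W1"
    using programs_for_list[OF gs V'(1-5) ts(1)] by auto
  obtain e2 W2 where W2: "finite W2" "\<forall>p\<in>W2. prime p" "W2 \<inter> ?V = {}" "computes e2 f ts q W2"
    using programmableE[OF f V'(1) V'(3) V'(6,7,5)] .
  let ?e = "Seq e1 (Seq e2 (clear ts))"
  have "(n, n') \<in> sem ?e \<longleftrightarrow> (\<exists>y. rec_eval (Comp_rf f gs) (vals rs n) y \<and> n' = n * q ^ y)"
    if n: "n > 0" "\<forall>p\<in>W1 \<union> W2 \<union> set ts. \<not> p dvd n" for n n'
  proof -
    have 1: "(n, z) \<in> sem e1 \<longleftrightarrow>
      (\<exists>ys. list_all2 (\<lambda>g y. rec_eval g (vals rs n) y) gs ys \<and> z = n * pow_prod ts ys)" for z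
      using computes_listD[OF W1(4) n(1)] n(2) by blast
    have 2: "(n * pow_prod ts ys, z) \<in> sem e2 \<longleftrightarrow>
        (\<exists>y. rec_eval f ys y \<and> z = n * q ^ y * pow_prod ts ys)" if "length ys = length gs" for ys z
    proof -
      have "\<not> p dvd n * pow_prod ts ys" if "p \<in> W2" for p
        using prime_dvd_pow_prod[of p ts n ys] W2 ts n that by auto
      then show ?thesis
        using computesD[OF W2(4), of "n * pow_prod ts ys" ys] n(1) pow_prod_pos[OF ts(3), of ys]
          vals_pow_prod[OF ts(2,3) n(1)] n(2) ts(1) \<open>length ys = _\<close> by (simp add: mult_ac)
    qed
    have 3: "(n * q ^ y * pow_prod ts ys, n') \<in> sem (clear ts) \<longleftrightarrow> n' = n * q ^ y" for y ys
    proof (rule sem_clear[OF ts(2,3)])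
      show "\<forall>t\<in>set ts. \<not> t dvd n * q ^ y"
      proof
        fix t assume "t \<in> set ts"
        then show "\<not> t dvd n * q ^ y"
          using prime_not_dvd_times[of t q n y] V(3,5) ts(3) V'(7) n(2) by auto
      qed
    qed
    have "(n, n') \<in> sem ?e \<longleftrightarrow> (\<exists>ys z. list_all2 (\<lambda>g y. rec_eval g (vals rs n) y) gs ys \<and>
        (n * pow_prod ts ys, z) \<in> sem e2 \<and> (z, n') \<in> sem (clear ts))"
      unfolding sem_Seq 1 by blast
    also have "\<dots> \<longleftrightarrow> (\<exists>ys y. list_all2 (\<lambda>g y. rec_eval g (vals rs n) y) gs ys \<and>
        rec_eval f ys y \<and> (n * q ^ y * pow_prod ts ys, n') \<in> sem (clear ts))"
    proof (rule ex_cong1)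
      fix ys
      show "(\<exists>z. list_all2 (\<lambda>g y. rec_eval g (vals rs n) y) gs ys \<and>
          (n * pow_prod ts ys, z) \<in> sem e2 \<and> (z, n') \<in> sem (clear ts)) \<longleftrightarrow>
        (\<exists>y. list_all2 (\<lambda>g y. rec_eval g (vals rs n) y) gs ys \<and>
          rec_eval f ys y \<and> (n * q ^ y * pow_prod ts ys, n') \<in> sem (clear ts))"
      proof (cases "list_all2 (\<lambda>g y. rec_eval g (vals rs n) y) gs ys")
        case True
        from 2[OF list_all2_lengthD[OF True, symmetric]] True show ?thesis by auto
      qed simp
    qed
    also have "\<dots> \<longleftrightarrow> (\<exists>y. rec_eval (Comp_rf f gs) (vals rs n) y \<and> n' = n * q ^ y)"
      unfolding ev 3 by blast
    finally show ?thesis .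
  qed
  then have "computes ?e (Comp_rf f gs) rs q (W1 \<union> W2 \<union> set ts)" unfolding computes_def by blast
  then show "\<exists>e W. finite W \<and> (\<forall>p\<in>W. prime p) \<and> W \<inter> V = {} \<and> computes e (Comp_rf f gs) rs q W"
    using W1 W2 ts by (intro exI[of _ ?e] exI[of _ "W1 \<union> W2 \<union> set ts"]) auto
qed

lemma prime_not_dvd_prime: "prime (p::nat) \<Longrightarrow> prime q \<Longrightarrow> p \<noteq> q \<Longrightarrow> \<not> p dvd q"
  using primes_dvd_imp_eq by blast

lemma sem_Iter_Seq_unfold:
  "(x, z) \<in> sem (Seq (Iter e) e') \<longleftrightarrow>
    (x, z) \<in> sem e' \<or> (\<exists>y. (x, y) \<in> sem e \<and> (y, z) \<in> sem (Seq (Iter e) e'))"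
  unfolding sem_Seq sem.simps(4)
  by (blast elim: converse_rtranclE intro: converse_rtrancl_into_rtrancl)

lemma rec_eval_Primrec_0: "rec_eval (Primrec_rf f g) (0 # xs) y \<longleftrightarrow> rec_eval f xs y"
  by (auto intro: rec_eval.primrec_0 elim: rec_eval.cases)

lemma rec_eval_Primrec_Suc:
  "rec_eval (Primrec_rf f g) (Suc n # xs) y \<longleftrightarrow>
    (\<exists>r. rec_eval (Primrec_rf f g) (n # xs) r \<and> rec_eval g (n # r # xs) y)"
  by (auto intro: rec_eval.primrec_Suc elim: rec_eval.cases)

lemma rec_eval_Primrec_Nil: "\<not> rec_eval (Primrec_rf f g) [] y"
  by (auto elim: rec_eval.cases)

text \<open>One round of the loop for primitive recursion: \<open>c\<close> counts the rounds done, \<open>a\<close> holds the value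
  reached, \<open>m\<close> the number of rounds left, and \<open>b\<close> receives the new value. Decrementing \<open>m\<close> first means
  that no round can start once \<open>m\<close> is empty.\<close>

lemma iterate_recursion_step:
  assumes g: "computes eg g (c # a # rs) b W"
    and c: "prime c" and a: "prime a" and b: "prime b" and m: "prime m"
    and dist: "distinct [c, a, b, m]" "set rs \<inter> {c, a, b, m} = {}"
    and W: "\<forall>p\<in>W. prime p" "W \<inter> ({c, a, b, m} \<union> set rs) = {}"
    and rs: "\<forall>p\<in>set rs. prime p"
    and n: "n > 0" "\<forall>p\<in>W \<union> {c, a, b, m}. \<not> p dvd n"
  defines "body \<equiv> Seq (Lin m 0 1 0) (Seq eg (Seq (transfer a 1) (Seq (transfer b a) (mul c))))"
  shows "(n * c ^ i * a ^ x * m ^ Suc k, n') \<in> sem body \<longleftrightarrow>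
      (\<exists>y. rec_eval g (i # x # vals rs n) y \<and> n' = n * c ^ Suc i * a ^ y * m ^ k)"
    and "(n * c ^ i * a ^ x, n') \<notin> sem body"
proof -
  have pos: "c > 0" "a > 0" "b > 0" "m > 0" using c a b m prime_gt_0_nat by auto
  have one: "\<not> p dvd 1" if "prime p" for p :: nat using that not_prime_unit by blast
  note nd = prime_not_dvd_times and mo = multiplicity_times_other_prime
    and ms = multiplicity_times_same_prime
  define N where "N = n * c ^ i * a ^ x * m ^ k"
  have Npos: "N > 0" using pos n by (simp add: N_def)
  have W_N: "\<not> p dvd N" if "p \<in> W" for p
  proof -
    have "prime p" "p \<noteq> c" "p \<noteq> a" "p \<noteq> m" "\<not> p dvd n" using that W n(2) by auto
    then show ?thesis unfolding N_def using c a m by (simp add: nd)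
  qed
  have v: "vals (c # a # rs) N = i # x # vals rs n"
  proof -
    have "multiplicity c N = i" "multiplicity a N = x"
      unfolding N_def using c a m dist n pos by (simp_all add: mo ms not_dvd_imp_multiplicity_0)
    moreover have "multiplicity p N = multiplicity p n" if "p \<in> set rs" for p
    proof -
      have "prime p" "p \<noteq> c" "p \<noteq> a" "p \<noteq> m" using that rs dist by auto
      then show ?thesis unfolding N_def using c a m n pos by (simp add: mo)
    qed
    ultimately show ?thesis by simp
  qed
  have 1: "(n * c ^ i * a ^ x * m ^ Suc k, z) \<in> sem (Lin m 0 1 0) \<longleftrightarrow> z = N" for z
    unfolding sem_scale using pos by (auto simp: N_def)
  have 2: "(N, z) \<in> sem eg \<longleftrightarrow> (\<exists>y. rec_eval g (i # x # vals rs n) y \<and> z = N * b ^ y)" for z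
    using computesD[OF g Npos W_N v] .
  have 3: "(N * b ^ y, z) \<in> sem (transfer a 1) \<longleftrightarrow> z = n * c ^ i * m ^ k * b ^ y" for y z
  proof -
    have "\<not> a dvd n * c ^ i * m ^ k * b ^ y" using a b c m dist n(2) by (simp add: nd)
    from sem_transfer[OF a _ one[OF a] this, of x z] show ?thesis
      unfolding N_def by (simp add: mult_ac)
  qed
  have 4: "(n * c ^ i * m ^ k * b ^ y, z) \<in> sem (transfer b a) \<longleftrightarrow> z = n * c ^ i * m ^ k * a ^ y"
    for y z
  proof (rule sem_transfer[OF b pos(2)])
    show "\<not> b dvd n * c ^ i * m ^ k" using a b c m dist n(2) by (simp add: nd)
    show "\<not> b dvd a" using dist by (intro prime_not_dvd_prime a b) auto
  qed
  have "(n * c ^ i * a ^ x * m ^ Suc k, n') \<in> sem body \<longleftrightarrow>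
      (\<exists>y. rec_eval g (i # x # vals rs n) y \<and> n' = n * c ^ i * m ^ k * a ^ y * c)"
    by (simp only: body_def sem_Seq 1 2 3 4 sem_mul ex_image_iff simp_thms)
  then show "(n * c ^ i * a ^ x * m ^ Suc k, n') \<in> sem body \<longleftrightarrow>
      (\<exists>y. rec_eval g (i # x # vals rs n) y \<and> n' = n * c ^ Suc i * a ^ y * m ^ k)"
    by (simp add: mult_ac)
  have "\<not> m dvd n * c ^ i * a ^ x" using a c m dist n(2) by (simp add: nd)
  then show "(n * c ^ i * a ^ x, n') \<notin> sem body"
    unfolding body_def sem_Seq sem_scale by (auto simp: dvd_def)
qed

text \<open>The loop stops only when \<open>m\<close> is empty, so from \<open>k\<close> rounds left the unique outcome is the value
  at \<open>i + k\<close>. That this is an equivalence uses that \<open>rec_eval\<close> is deterministic: a value at \<open>i + k\<close>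
  can only have come from the value \<open>x\<close> at \<open>i\<close>.\<close>

lemma iterate_recursion:
  assumes g: "computes eg g (c # a # rs) b W"
    and c: "prime c" and a: "prime a" and b: "prime b" and m: "prime m"
    and dist: "distinct [c, a, b, m]" "set rs \<inter> {c, a, b, m} = {}"
    and W: "\<forall>p\<in>W. prime p" "W \<inter> ({c, a, b, m} \<union> set rs) = {}"
    and rs: "\<forall>p\<in>set rs. prime p"
    and n: "n > 0" "\<forall>p\<in>W \<union> {c, a, b, m}. \<not> p dvd n"
    and x: "rec_eval (Primrec_rf f g) (i # vals rs n) x"
  defines "body \<equiv> Seq (Lin m 0 1 0) (Seq eg (Seq (transfer a 1) (Seq (transfer b a) (mul c))))"
  shows "(n * c ^ i * a ^ x * m ^ k, n') \<in> sem (Seq (Iter body) (not_dvd_test m)) \<longleftrightarrow>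
      (\<exists>y. rec_eval (Primrec_rf f g) ((i + k) # vals rs n) y \<and> n' = n * c ^ (i + k) * a ^ y)"
  using x
proof (induction k arbitrary: i x)
  case 0
  have pos: "n * c ^ i * a ^ x > 0" using n c a prime_gt_0_nat by simp
  have "\<not> m dvd n * c ^ i * a ^ x" using a c m dist n(2) by (simp add: prime_not_dvd_times)
  then have test: "(n * c ^ i * a ^ x, n') \<in> sem (not_dvd_test m) \<longleftrightarrow> n' = n * c ^ i * a ^ x"
    using sem_not_dvd_test[OF pos prime_gt_0_nat[OF m], of n'] by blast
  have iter: "(n * c ^ i * a ^ x, z) \<in> (sem body)\<^sup>* \<longleftrightarrow> z = n * c ^ i * a ^ x" for z
  proof
    assume "(n * c ^ i * a ^ x, z) \<in> (sem body)\<^sup>*"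
    then show "z = n * c ^ i * a ^ x"
      using iterate_recursion_step(2)[OF g c a b m dist W rs n, folded body_def]
      by (cases rule: converse_rtranclE) auto
  qed simp
  have "(n * c ^ i * a ^ x, n') \<in> sem (Seq (Iter body) (not_dvd_test m)) \<longleftrightarrow>
      n' = n * c ^ i * a ^ x"
    by (simp only: sem_Seq sem.simps(4) iter test simp_thms)
  moreover have "rec_eval (Primrec_rf f g) (i # vals rs n) y \<longleftrightarrow> y = x" for y
    using 0 rec_eval_deterministic by blast
  ultimately show ?case by simp
next
  case (Suc k)
  have step: "(n * c ^ i * a ^ x * m ^ Suc k, z) \<in> sem body \<longleftrightarrow>
      (\<exists>y. rec_eval g (i # x # vals rs n) y \<and> z = n * c ^ Suc i * a ^ y * m ^ k)" for z
    using iterate_recursion_step(1)[OF g c a b m dist W rs n, folded body_def] .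
  have pos: "n * c ^ i * a ^ x * m ^ Suc k > 0" using n c a m prime_gt_0_nat by simp
  have "(n * c ^ i * a ^ x * m ^ Suc k, n') \<notin> sem (not_dvd_test m)"
    unfolding sem_not_dvd_test[OF pos prime_gt_0_nat[OF m]] by simp
  then have "(n * c ^ i * a ^ x * m ^ Suc k, n') \<in> sem (Seq (Iter body) (not_dvd_test m)) \<longleftrightarrow>
      (\<exists>z. (n * c ^ i * a ^ x * m ^ Suc k, z) \<in> sem body \<and>
        (z, n') \<in> sem (Seq (Iter body) (not_dvd_test m)))"
    using sem_Iter_Seq_unfold[of "n * c ^ i * a ^ x * m ^ Suc k" n' body "not_dvd_test m"]
    by (simp only: simp_thms)
  also have "\<dots> \<longleftrightarrow> (\<exists>y. rec_eval g (i # x # vals rs n) y \<and>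
      (n * c ^ Suc i * a ^ y * m ^ k, n') \<in> sem (Seq (Iter body) (not_dvd_test m)))"
    by (simp only: step ex_image_iff)
  also have "\<dots> \<longleftrightarrow> (\<exists>y. rec_eval g (i # x # vals rs n) y \<and>
      (\<exists>y. rec_eval (Primrec_rf f g) ((Suc i + k) # vals rs n) y \<and> n' = n * c ^ (Suc i + k) * a ^ y))"
    using Suc.IH rec_eval.primrec_Suc[OF Suc.prems] by blast
  also have "\<dots> \<longleftrightarrow>
      (\<exists>y. rec_eval (Primrec_rf f g) ((Suc i + k) # vals rs n) y \<and> n' = n * c ^ (Suc i + k) * a ^ y)"
  proof -
    have "\<exists>y. rec_eval (Primrec_rf f g) (Suc i # vals rs n) y"
      if "rec_eval (Primrec_rf f g) ((Suc i + k) # vals rs n) y" for y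
      using that
    proof (induction k arbitrary: y)
      case (Suc k)
      then show ?case using rec_eval_Primrec_Suc[of f g "Suc i + k" "vals rs n"] by auto
    qed auto
    moreover have "\<exists>y. rec_eval g (i # x # vals rs n) y"
      if "rec_eval (Primrec_rf f g) (Suc i # vals rs n) y" for y
      using that Suc.prems rec_eval_deterministic unfolding rec_eval_Primrec_Suc by blast
    ultimately show ?thesis by blast
  qed
  finally show ?case by simp
qed

lemma programmable_Primrec:
  assumes f: "programmable f" and g: "programmable g"
  shows "programmable (Primrec_rf f g)"
  unfolding programmable_def
proof (intro allI impI, elim conjE)
  fix rs :: "nat list" and q :: nat and V :: "nat set"
  assume V: "finite V" "set rs \<subseteq> V" "q \<in> V" "q \<notin> set rs" "\<forall>p\<in>V. prime p"
  show "\<exists>e W. finite W \<and> (\<forall>p\<in>W. prime p) \<and> W \<inter> V = {} \<and> computes e (Primrec_rf f g) rs q W"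
  proof (cases rs)
    case Nil
    then have "computes (Lin 0 0 0 0) (Primrec_rf f g) rs q {}"
      by (intro computes_undefined) (simp add: rec_eval_Primrec_Nil)
    then show ?thesis by (intro exI[of _ "Lin 0 0 0 0"] exI[of _ "{}"]) auto
  next
    case (Cons r rs')
    obtain ts where ts: "length ts = 5" "distinct ts" "\<forall>t\<in>set ts. prime t" "set ts \<inter> V = {}"
      using fresh_primes[OF V(1)] .
    obtain c a b m t where [simp]: "ts = [c, a, b, m, t]"
      using ts(1) by (auto simp: numeral_eq_Suc length_Suc_conv)
    let ?V = "V \<union> set ts"
    have V': "finite ?V" "set rs' \<subseteq> ?V" "a \<in> ?V" "a \<notin> set rs'" "\<forall>p\<in>?V. prime p"
      "set (c # a # rs') \<subseteq> ?V" "b \<in> ?V" "b \<notin> set (c # a # rs')"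
      using V ts Cons by auto
    obtain e1 W1 where W1: "finite W1" "\<forall>p\<in>W1. prime p" "W1 \<inter> ?V = {}" "computes e1 f rs' a W1"
      using programmableE[OF f V'(1-5)] .
    obtain e2 W2 where W2: "finite W2" "\<forall>p\<in>W2. prime p" "W2 \<inter> ?V = {}"
        "computes e2 g (c # a # rs') b W2"
      using programmableE[OF g V'(1,6-8,5)] .
    have p: "prime c" "prime a" "prime b" "prime m" "prime t" "prime r" "prime q"
      using ts V Cons by auto
    have d: "distinct [c, a, b, m]" "set rs' \<inter> {c, a, b, m} = {}" "r \<notin> {c, a, b, m, t}"
      "t \<notin> {c, a, b, m}" "q \<notin> {c, a, b, m, t}"
      using ts V Cons by auto
    have W2': "W2 \<inter> ({c, a, b, m} \<union> set rs') = {}" using W2(3) V(2) Cons by auto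
    have rs': "\<forall>p\<in>set rs'. prime p" using V Cons by auto
    define body where
      "body = Seq (Lin m 0 1 0) (Seq e2 (Seq (transfer a 1) (Seq (transfer b a) (mul c))))"
    define lp where "lp = Seq (Iter body) (not_dvd_test m)"
    let ?e = "Seq e1 (Seq (copy r m t) (Seq lp (Seq (transfer a q) (transfer c 1))))"
    have "(n, n') \<in> sem ?e \<longleftrightarrow> (\<exists>y. rec_eval (Primrec_rf f g) (vals rs n) y \<and> n' = n * q ^ y)"
      if n: "n > 0" "\<forall>p\<in>W1 \<union> W2 \<union> set ts. \<not> p dvd n" for n n'
    proof -
      define k where "k = multiplicity r n"
      have n2: "\<forall>p\<in>W2 \<union> {c, a, b, m}. \<not> p dvd n" using n by auto
      have 1: "(n, z) \<in> sem e1 \<longleftrightarrow> (\<exists>y. rec_eval f (vals rs' n) y \<and> z = n * a ^ y)" for z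
        using computesD[OF W1(4) n(1)] n(2) by blast
      have 2: "(n * a ^ x, z) \<in> sem (copy r m t) \<longleftrightarrow> z = n * a ^ x * m ^ k" for x z
      proof -
        have "\<not> t dvd n * a ^ x" using prime_not_dvd_times[of t a n x] p d n(2) by auto
        moreover have "multiplicity r (n * a ^ x) = k"
          unfolding k_def using p d n(1) by (simp add: multiplicity_times_other_prime)
        ultimately show ?thesis
          using sem_copy[of r m t "n * a ^ x" z] p d n(1) prime_gt_0_nat by auto
      qed
      have 3: "(n * a ^ x * m ^ k, z) \<in> sem lp \<longleftrightarrow>
          (\<exists>y. rec_eval (Primrec_rf f g) (k # vals rs' n) y \<and> z = n * c ^ k * a ^ y)"
        if "rec_eval f (vals rs' n) x" for x z
        using iterate_recursion[OF W2(4) p(1-4) d(1,2) W2(2) W2' rs' n(1) n2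
            rec_eval.primrec_0[OF that], of k z]
        unfolding lp_def body_def by simp
      have 4: "(n * c ^ k * a ^ y, z) \<in> sem (transfer a q) \<longleftrightarrow> z = n * q ^ y * c ^ k" for y z
      proof -
        have "\<not> a dvd n * c ^ k" using prime_not_dvd_times[of a c n k] p d n(2) by auto
        moreover have "\<not> a dvd q" using d by (intro prime_not_dvd_prime p) auto
        ultimately show ?thesis
          using sem_transfer[OF p(2), of q "n * c ^ k" y z] prime_gt_0_nat[OF p(7)]
          by (simp add: mult_ac)
      qed
      have 5: "(n * q ^ y * c ^ k, z) \<in> sem (transfer c 1) \<longleftrightarrow> z = n * q ^ y" for y z
      proof -
        have "\<not> c dvd n * q ^ y" using prime_not_dvd_times[of c q n y] p d n(2) by auto
        then show ?thesis
          using sem_transfer[OF p(1), of 1 "n * q ^ y" k z] not_prime_unit p(1) by auto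
      qed
      have "(n, n') \<in> sem ?e \<longleftrightarrow> (\<exists>x z. rec_eval f (vals rs' n) x \<and>
          (n * a ^ x * m ^ k, z) \<in> sem lp \<and> (z, n') \<in> sem (Seq (transfer a q) (transfer c 1)))"
        unfolding sem_Seq 1 ex_image_iff 2 by blast
      also have "\<dots> \<longleftrightarrow> (\<exists>x y. rec_eval f (vals rs' n) x \<and>
          rec_eval (Primrec_rf f g) (k # vals rs' n) y \<and> n' = n * q ^ y)"
      proof (rule ex_cong1)
        fix x
        show "(\<exists>z. rec_eval f (vals rs' n) x \<and>
            (n * a ^ x * m ^ k, z) \<in> sem lp \<and> (z, n') \<in> sem (Seq (transfer a q) (transfer c 1))) \<longleftrightarrow>
          (\<exists>y. rec_eval f (vals rs' n) x \<and>
            rec_eval (Primrec_rf f g) (k # vals rs' n) y \<and> n' = n * q ^ y)"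
        proof (cases "rec_eval f (vals rs' n) x")
          case True
          then show ?thesis by (simp only: 3[OF True] ex_image_iff sem_Seq 4 5 simp_thms)
        qed simp
      qed
      also have "\<dots> \<longleftrightarrow> (\<exists>y. rec_eval (Primrec_rf f g) (k # vals rs' n) y \<and> n' = n * q ^ y)"
      proof -
        have "\<exists>x. rec_eval f (vals rs' n) x"
          if "rec_eval (Primrec_rf f g) (k # vals rs' n) y" for y
          using that by (induction k arbitrary: y) (auto simp: rec_eval_Primrec_0 rec_eval_Primrec_Suc)
        then show ?thesis by blast
      qed
      finally show ?thesis by (simp add: Cons k_def)
    qed
    then have "computes ?e (Primrec_rf f g) rs q (W1 \<union> W2 \<union> set ts)" unfolding computes_def by blast
    then show ?thesis using W1 W2 ts
      by (intro exI[of _ ?e] exI[of _ "W1 \<union> W2 \<union> set ts"]) auto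
  qed
qed

text \<open>The search loop may only continue past a candidate whose value is positive, which is tested
  by decrementing the register \<open>b\<close> that holds it; it may only stop at a candidate with value \<open>0\<close>, tested by
  \<open>not_dvd_test b\<close>. Hence divergence of the search leaves no pair in the relation.\<close>

lemma programmable_Mu:
  assumes f: "programmable f"
  shows "programmable (Mu_rf f)"
  unfolding programmable_def
proof (intro allI impI, elim conjE)
  fix rs :: "nat list" and q :: nat and V :: "nat set"
  assume V: "finite V" "set rs \<subseteq> V" "q \<in> V" "q \<notin> set rs" "\<forall>p\<in>V. prime p"
  have ev: "rec_eval (Mu_rf f) xs i \<longleftrightarrow>
      rec_eval f (i # xs) 0 \<and> (\<forall>j<i. \<exists>k. rec_eval f (j # xs) (Suc k))" for xs i
  proof
    assume "rec_eval (Mu_rf f) xs i"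
    then show "rec_eval f (i # xs) 0 \<and> (\<forall>j<i. \<exists>k. rec_eval f (j # xs) (Suc k))" by cases auto
  qed (auto intro: rec_eval.mu)
  obtain ts where ts: "length ts = 2" "distinct ts" "\<forall>t\<in>set ts. prime t" "set ts \<inter> V = {}"
    using fresh_primes[OF V(1)] .
  obtain c b where [simp]: "ts = [c, b]"
    using ts(1) by (auto simp: numeral_eq_Suc length_Suc_conv)
  let ?V = "V \<union> set ts"
  have V': "finite ?V" "set (c # rs) \<subseteq> ?V" "b \<in> ?V" "b \<notin> set (c # rs)" "\<forall>p\<in>?V. prime p"
    using V ts by auto
  obtain e W where W: "finite W" "\<forall>p\<in>W. prime p" "W \<inter> ?V = {}" "computes e f (c # rs) b W"
    using programmableE[OF f V'] .
  have p: "prime c" "prime b" "prime q" and d: "c \<noteq> b" "c \<noteq> q" "b \<noteq> q" "c \<notin> set rs"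
    using ts V by auto
  have pos: "c > 0" "b > 0" "q > 0" using p prime_gt_0_nat by auto
  define body where "body = Seq e (Seq (Lin b 0 1 0) (Seq (transfer b 1) (mul c)))"
  let ?e = "Seq (Iter body) (Seq e (Seq (not_dvd_test b) (transfer c q)))"
  have "(n, n') \<in> sem ?e \<longleftrightarrow> (\<exists>i. rec_eval (Mu_rf f) (vals rs n) i \<and> n' = n * q ^ i)"
    if n: "n > 0" "\<forall>p\<in>W \<union> set ts. \<not> p dvd n" for n n'
  proof -
    have 1: "(n * c ^ i, z) \<in> sem e \<longleftrightarrow> (\<exists>y. rec_eval f (i # vals rs n) y \<and> z = n * c ^ i * b ^ y)"
      for i z
    proof (rule computesD[OF W(4)])
      show "n * c ^ i > 0" using n pos by simp
      show "\<not> p dvd n * c ^ i" if "p \<in> W" for p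
        using prime_not_dvd_times[of p c n i] W(2,3) that p n(2) by auto
      have "multiplicity c (n * c ^ i) = i"
        using multiplicity_times_same_prime[OF p(1) n(1)] n(2) by (simp add: not_dvd_imp_multiplicity_0)
      moreover have "vals rs (n * c ^ i) = vals rs n"
        using V(2,5) by (intro vals_times_prime p d n) auto
      ultimately show "vals (c # rs) (n * c ^ i) = i # vals rs n" by simp
    qed
    have nb: "\<not> b dvd n * c ^ i" for i using p d n(2) by (simp add: prime_not_dvd_times)
    have 2: "(n * c ^ i * b ^ y, z) \<in> sem (Lin b 0 1 0) \<longleftrightarrow> (\<exists>y'. y = Suc y' \<and> z = n * c ^ i * b ^ y')"
      for i y z
      using nb[of i] pos unfolding sem_scale by (cases y) auto
    have 3: "(n * c ^ i * b ^ y, z) \<in> sem (transfer b 1) \<longleftrightarrow> z = n * c ^ i" for i y z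
      using sem_transfer[OF p(2) _ _ nb, of 1 i y z] not_prime_unit p(2) by auto
    have body_step: "(n * c ^ i, z) \<in> sem body \<longleftrightarrow>
        (\<exists>k. rec_eval f (i # vals rs n) (Suc k)) \<and> z = n * c ^ Suc i" for i z
      by (simp only: body_def sem_Seq 1 2 3 sem_mul ex_image_iff simp_thms) (auto simp: mult_ac)
    have iter: "(n, z) \<in> (sem body)\<^sup>* \<longleftrightarrow>
        (\<exists>i. z = n * c ^ i \<and> (\<forall>j<i. \<exists>k. rec_eval f (j # vals rs n) (Suc k)))" for z
    proof
      assume "(n, z) \<in> (sem body)\<^sup>*"
      then show "\<exists>i. z = n * c ^ i \<and> (\<forall>j<i. \<exists>k. rec_eval f (j # vals rs n) (Suc k))"
      proof (induction rule: rtrancl_induct)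
        case base
        then show ?case by (intro exI[of _ 0]) simp
      next
        case (step y z)
        then obtain i where i: "y = n * c ^ i" "\<forall>j<i. \<exists>k. rec_eval f (j # vals rs n) (Suc k)" by blast
        then show ?case using step(2) body_step[of i z] by (intro exI[of _ "Suc i"]) (auto simp: less_Suc_eq)
      qed
    next
      assume "\<exists>i. z = n * c ^ i \<and> (\<forall>j<i. \<exists>k. rec_eval f (j # vals rs n) (Suc k))"
      then obtain i where "z = n * c ^ i" "\<forall>j<i. \<exists>k. rec_eval f (j # vals rs n) (Suc k)" by blast
      then show "(n, z) \<in> (sem body)\<^sup>*"
      proof (induction i arbitrary: z)
        case (Suc i)
        then have "(n, n * c ^ i) \<in> (sem body)\<^sup>*" by simp
        moreover have "(n * c ^ i, z) \<in> sem body" using body_step[of i z] Suc.prems by blast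
        ultimately show ?case by (rule rtrancl_into_rtrancl)
      qed simp
    qed
    have 4: "(n * c ^ i * b ^ y, z) \<in> sem (not_dvd_test b) \<longleftrightarrow> y = 0 \<and> z = n * c ^ i" for i y z
      using sem_not_dvd_test[of "n * c ^ i * b ^ y" b z] nb[of i] n(1) pos by (cases y) auto
    have 5: "(n * c ^ i, z) \<in> sem (transfer c q) \<longleftrightarrow> z = n * q ^ i" for i z
    proof (rule sem_transfer[OF p(1) pos(3)])
      show "\<not> c dvd q" using d by (intro prime_not_dvd_prime p)
      show "\<not> c dvd n" using n(2) by simp
    qed
    have "(n, n') \<in> sem ?e \<longleftrightarrow> (\<exists>i. (\<forall>j<i. \<exists>k. rec_eval f (j # vals rs n) (Suc k)) \<and>
        (n * c ^ i, n') \<in> sem (Seq e (Seq (not_dvd_test b) (transfer c q))))"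
      unfolding sem_Seq sem.simps(4) iter by blast
    also have "\<dots> \<longleftrightarrow> (\<exists>i. rec_eval (Mu_rf f) (vals rs n) i \<and> n' = n * q ^ i)"
    proof -
      have "(n * c ^ i, n') \<in> sem (Seq e (Seq (not_dvd_test b) (transfer c q))) \<longleftrightarrow>
          rec_eval f (i # vals rs n) 0 \<and> n' = n * q ^ i" for i
        by (simp only: sem_Seq 1 ex_image_iff 4 conj_assoc ex_simps simp_thms 5)
          (simp only: mult_1_right power_0 simp_thms 5 conj_left_commute[of _ "_ = 0"] ex_simps)
      then show ?thesis unfolding ev by blast
    qed
    finally show ?thesis .
  qed
  then have "computes ?e (Mu_rf f) rs q (W \<union> set ts)" unfolding computes_def by blast
  then show "\<exists>e W. finite W \<and> (\<forall>p\<in>W. prime p) \<and> W \<inter> V = {} \<and> computes e (Mu_rf f) rs q W"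
    using W ts by (intro exI[of _ ?e] exI[of _ "W \<union> set ts"]) auto
qed

theorem all_programmable: "programmable f"
proof (induction f)
  case (Comp_rf f gs)
  then show ?case by (intro programmable_Comp) auto
qed (simp_all add: programmable_Zero programmable_Succ programmable_Proj programmable_Primrec
    programmable_Mu)

text \<open>The argument \<open>x\<close> sits in register 2 and the result in register 3. Multiplying by \<open>0\<close> at
  the end gives all halting computations the same final number.\<close>

corollary halting_program:
  "\<exists>e. \<forall>x. (2 ^ x, 0) \<in> sem e \<longleftrightarrow> (\<exists>y. rec_eval f [x] y)"
proof -
  have V: "finite {2, 3::nat}" "set [2] \<subseteq> {2, 3::nat}" "3 \<in> {2, 3::nat}" "3 \<notin> set [2::nat]"
    "\<forall>p\<in>{2, 3::nat}. prime p" by auto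
  obtain e W where W: "finite W" "\<forall>p\<in>W. prime p" "W \<inter> {2, 3} = {}" "computes e f [2] 3 W"
    using programmableE[OF all_programmable V] .
  have "\<not> p dvd 2 ^ x" if "p \<in> W" for p x
  proof
    assume "p dvd 2 ^ x"
    moreover have "prime p" using W(2) that by blast
    ultimately have "p = 2" using prime_dvd_power primes_dvd_imp_eq two_is_prime_nat by blast
    then show False using that W(3) by blast
  qed
  then have "(2 ^ x, z) \<in> sem e \<longleftrightarrow> (\<exists>y. rec_eval f [x] y \<and> z = 2 ^ x * 3 ^ y)" for x z
    using computesD[OF W(4), of "2 ^ x" "[x]"] by (simp add: multiplicity_same_power)
  then have "(2 ^ x, 0) \<in> sem (Seq e (mul 0)) \<longleftrightarrow> (\<exists>y. rec_eval f [x] y)" for x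
    unfolding sem_Seq sem_mul by auto
  then show ?thesis by blast
qed

section \<open>The group and its line of conjugates\<close>

text \<open>With \<open>a\<close> for the generator 0 and \<open>t\<close> for the generator 1 this is the commutator of \<open>a\<close> and \<open>t a t\<inverse>\<close>.\<close>

definition commutator_word :: "nat word" where
  "commutator_word = [Inl 0, Inl 1, Inl 0, Inr 1, Inr 0, Inl 1, Inr 0, Inr 1]"

definition gens :: "nat set" where "gens = {0, 1}"

definition eqv :: "nat word \<Rightarrow> nat word \<Rightarrow> bool" (infix "\<approx>" 50) where
  "u \<approx> v \<longleftrightarrow> (u, v) \<in> pres_cong gens {(commutator_word, [])}"

lemma eqv_refl [simp]: "u \<in> words gens \<Longrightarrow> u \<approx> u"
  by (simp add: eqv_def pres_cong.refl)

lemma eqv_sym: "u \<approx> v \<Longrightarrow> v \<approx> u"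
  by (simp add: eqv_def pres_cong.sym)

lemma eqv_trans [trans]: "u \<approx> v \<Longrightarrow> v \<approx> w \<Longrightarrow> u \<approx> w"
  unfolding eqv_def by (rule pres_cong.trans)

lemma eqv_append: "u \<approx> v \<Longrightarrow> u' \<approx> v' \<Longrightarrow> u @ u' \<approx> v @ v'"
  unfolding eqv_def by (rule pres_cong.append)

lemma eqv_context: "u \<approx> v \<Longrightarrow> x \<in> words gens \<Longrightarrow> y \<in> words gens \<Longrightarrow> x @ u @ y \<approx> x @ v @ y"
  by (intro eqv_append eqv_refl)

lemma gen_letters [simp]: "Inl 0 \<in> gens <+> gens" "Inl (Suc 0) \<in> gens <+> gens"
  "Inr 0 \<in> gens <+> gens" "Inr (Suc 0) \<in> gens <+> gens"
  by (auto simp: gens_def)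

lemma eqv_cancel: "l \<in> gens <+> gens \<Longrightarrow> [l, inv_letter l] \<approx> []"
  unfolding eqv_def by (rule pres_cong.cancel)

lemma eqv_cancels:
  "[Inl 0, Inr 0] \<approx> []" "[Inr 0, Inl 0] \<approx> []" "[Inl 1, Inr 1] \<approx> []" "[Inr 1, Inl 1] \<approx> []"
  using eqv_cancel[of "Inl 0"] eqv_cancel[of "Inr 0"] eqv_cancel[of "Inl 1"] eqv_cancel[of "Inr 1"]
  by (auto simp: inv_letter_def)

lemma base_commute: "[Inl 0, Inl 1, Inl 0, Inr 1] \<approx> [Inl 1, Inl 0, Inr 1, Inl 0]"
proof -
  let ?a = "Inl 0 :: nat + nat" and ?t = "Inl 1 :: nat + nat"
  let ?A = "Inr 0 :: nat + nat" and ?T = "Inr 1 :: nat + nat"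
  have rel: "[?a, ?t, ?a, ?T, ?A, ?t, ?A, ?T] \<approx> []"
    unfolding eqv_def commutator_word_def by (rule pres_cong.relation) auto
  have "[?A, ?t, ?A, ?T] @ [?t, ?a, ?T, ?a] \<approx> [?A, ?t, ?A] @ [?a, ?T, ?a]"
    using eqv_context[OF eqv_cancels(4), of "[?A, ?t, ?A]" "[?a, ?T, ?a]"] by simp
  also have "\<dots> \<approx> [?A, ?t] @ [?T, ?a]"
    using eqv_context[OF eqv_cancels(2), of "[?A, ?t]" "[?T, ?a]"] by simp
  also have "\<dots> \<approx> [?A] @ [?a]"
    using eqv_context[OF eqv_cancels(3), of "[?A]" "[?a]"] by simp
  also have "\<dots> \<approx> []" using eqv_cancels(2) by simp
  finally have inv: "[?A, ?t, ?A, ?T] @ [?t, ?a, ?T, ?a] \<approx> []" .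
  have "[?a, ?t, ?a, ?T] \<approx> [?a, ?t, ?a, ?T] @ [?A, ?t, ?A, ?T] @ [?t, ?a, ?T, ?a]"
    using eqv_sym[OF eqv_context[OF inv, of "[?a, ?t, ?a, ?T]" "[]"]] by simp
  also have "\<dots> \<approx> [?t, ?a, ?T, ?a]"
    using eqv_context[OF rel, of "[]" "[?t, ?a, ?T, ?a]"] by simp
  finally show ?thesis .
qed

definition tpow :: "int \<Rightarrow> nat word" where
  "tpow i = (if i \<ge> 0 then replicate (nat i) (Inl 1) else replicate (nat (- i)) (Inr 1))"

lemma replicate_in_words [simp]: "l \<in> A <+> A \<Longrightarrow> replicate n l \<in> words A"
  by (induction n) auto

lemma tpow_in_words [simp]: "tpow i \<in> words gens"
  by (auto simp: tpow_def)

lemma replicate_cancel: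
  assumes "l \<in> gens <+> gens"
  shows "replicate n l @ replicate n (inv_letter l) \<approx> []"
proof (induction n)
  case (Suc n)
  have "replicate (Suc n) l @ replicate (Suc n) (inv_letter l) =
      replicate n l @ [l, inv_letter l] @ replicate n (inv_letter l)"
    by (simp flip: replicate_append_same)
  also have "\<dots> \<approx> replicate n l @ [] @ replicate n (inv_letter l)"
    using assms by (intro eqv_context eqv_cancel) auto
  also have "\<dots> \<approx> []" using Suc by simp
  finally show ?case .
qed simp

lemma tpow_cancel: "tpow i @ tpow (- i) \<approx> []"
  using replicate_cancel[of "Inl 1" "nat i"] replicate_cancel[of "Inr 1" "nat (- i)"]
  by (auto simp: tpow_def inv_letter_def)

lemma tpow_Suc: "tpow (i + 1) \<approx> tpow i @ [Inl 1]"
proof (cases i rule: int_cases)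
  case (nonneg n)
  then have "tpow (i + 1) = tpow i @ [Inl 1]"
    by (simp add: tpow_def nat_add_distrib flip: replicate_append_same)
  then show ?thesis by simp
next
  case (neg k)
  then have "i < 0" "nat (- i) = Suc k" "nat (- (i + 1)) = k" by simp_all
  note exponents = this
  have "tpow i @ [Inl 1] = replicate k (Inr 1) @ [Inr 1, Inl 1] @ []"
    using exponents by (simp add: tpow_def flip: replicate_append_same)
  also have "\<dots> \<approx> replicate k (Inr 1) @ [] @ []" by (intro eqv_context eqv_cancels) auto
  also have "\<dots> = tpow (i + 1)" using neg exponents by (auto simp: tpow_def)
  finally show ?thesis by (rule eqv_sym)
qed

lemma tpow_minus_Suc: "tpow (- (i + 1)) \<approx> [Inr 1] @ tpow (- i)"
proof -
  have "[Inr 1] @ tpow (- i) \<approx> [Inr 1] @ tpow (- i) @ tpow (i + 1) @ tpow (- (i + 1))"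
    using eqv_sym[OF eqv_context[OF tpow_cancel, of "[Inr 1] @ tpow (- i)" "[]" "i + 1"]] by simp
  also have "\<dots> \<approx> [Inr 1] @ tpow (- i) @ (tpow i @ [Inl 1]) @ tpow (- (i + 1))"
    using eqv_context[OF tpow_Suc, of "[Inr 1] @ tpow (- i)" "tpow (- (i + 1))" i] by simp
  also have "\<dots> \<approx> [Inr 1] @ [Inl 1] @ tpow (- (i + 1))"
    using eqv_context[OF tpow_cancel[of "- i"], of "[Inr 1]" "[Inl 1] @ tpow (- (i + 1))"] by simp
  also have "\<dots> \<approx> tpow (- (i + 1))"
    using eqv_context[OF eqv_cancels(4), of "[]" "tpow (- (i + 1))"] by simp
  finally show ?thesis by (rule eqv_sym)
qed

text \<open>The letter \<open>(i, True)\<close> stands for \<open>t\<^sup>i a t\<^sup>-\<^sup>i\<close> and \<open>(i, False)\<close> for its inverse. Only this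
  subgroup is used from here on.\<close>

type_synonym line_word = "(int \<times> bool) list"

definition expand_letter :: "int \<times> bool \<Rightarrow> nat word" where
  "expand_letter = (\<lambda>(i, e). tpow i @ [if e then Inl 0 else Inr 0] @ tpow (- i))"

definition expand :: "line_word \<Rightarrow> nat word" where
  "expand u = concat (map expand_letter u)"

lemma expand_simps [simp]:
  "expand [] = []" "expand (l # u) = expand_letter l @ expand u" "expand (u @ v) = expand u @ expand v"
  by (auto simp: expand_def)

lemma expand_letter_in_words [simp]: "expand_letter l \<in> words gens"
  by (auto simp: expand_letter_def split: prod.split)

lemma expand_in_words [simp]: "expand u \<in> words gens"
  by (induction u) auto

definition line_eqv :: "line_word \<Rightarrow> line_word \<Rightarrow> bool" (infix "\<sim>" 50) where
  "u \<sim> v \<longleftrightarrow> expand u \<approx> expand v"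

lemma line_eqv_refl [simp]: "u \<sim> u" by (simp add: line_eqv_def)

lemma line_eqv_sym: "u \<sim> v \<Longrightarrow> v \<sim> u" unfolding line_eqv_def by (rule eqv_sym)

lemma line_eqv_trans [trans]: "u \<sim> v \<Longrightarrow> v \<sim> w \<Longrightarrow> u \<sim> w"
  unfolding line_eqv_def by (rule eqv_trans)

lemma line_eqv_append: "u \<sim> v \<Longrightarrow> u' \<sim> v' \<Longrightarrow> u @ u' \<sim> v @ v'"
  unfolding line_eqv_def by (simp add: eqv_append)

lemma line_eqv_context: "u \<sim> v \<Longrightarrow> x @ u @ y \<sim> x @ v @ y"
  by (intro line_eqv_append line_eqv_refl)

lemma line_eqv_cancel: "[(i, e), (i, \<not> e)] \<sim> []"
proof -
  let ?x = "if e then Inl 0 else Inr 0 :: nat + nat" and ?x' = "if e then Inr 0 else Inl 0 :: nat + nat"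
  have "expand [(i, e), (i, \<not> e)] = (tpow i @ [?x]) @ (tpow (- i) @ tpow i) @ ([?x'] @ tpow (- i))"
    by (auto simp: expand_letter_def)
  also have "\<dots> \<approx> (tpow i @ [?x]) @ [] @ ([?x'] @ tpow (- i))"
    using tpow_cancel[of "- i"] by (intro eqv_context) auto
  also have "\<dots> = tpow i @ [?x, ?x'] @ tpow (- i)" by simp
  also have "\<dots> \<approx> tpow i @ [] @ tpow (- i)"
    using eqv_cancels by (intro eqv_context) auto
  also have "\<dots> \<approx> []" using tpow_cancel by simp
  finally show ?thesis by (simp add: line_eqv_def)
qed

text \<open>Neighbouring letters commute: this is the defining relation conjugated by \<open>t\<^sup>i\<close>.\<close>

lemma line_commute: "[(i, True), (i + 1, True)] \<sim> [(i + 1, True), (i, True)]"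
proof -
  let ?a = "Inl 0 :: nat + nat" and ?t = "Inl 1 :: nat + nat" and ?T = "Inr 1 :: nat + nat"
  have next_letter: "expand_letter (i + 1, True) \<approx> tpow i @ [?t, ?a, ?T] @ tpow (- i)"
    using eqv_append[OF tpow_Suc eqv_append[OF eqv_refl[of "[?a]"] tpow_minus_Suc], of i i]
    by (simp add: expand_letter_def)
  have "expand [(i, True), (i + 1, True)] \<approx>
      (tpow i @ [?a]) @ (tpow (- i) @ tpow i) @ ([?t, ?a, ?T] @ tpow (- i))"
    using eqv_append[OF eqv_refl next_letter, of "expand_letter (i, True)"]
    by (simp add: expand_letter_def)
  also have "\<dots> \<approx> (tpow i @ [?a]) @ [] @ ([?t, ?a, ?T] @ tpow (- i))"
    using tpow_cancel[of "- i"] by (intro eqv_context) auto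
  also have "\<dots> = tpow i @ [?a, ?t, ?a, ?T] @ tpow (- i)" by simp
  also have "\<dots> \<approx> tpow i @ [?t, ?a, ?T, ?a] @ tpow (- i)"
    using base_commute by (intro eqv_context) auto
  also have "\<dots> = (tpow i @ [?t, ?a, ?T]) @ [] @ ([?a] @ tpow (- i))" by simp
  also have "\<dots> \<approx> (tpow i @ [?t, ?a, ?T]) @ (tpow (- i) @ tpow i) @ ([?a] @ tpow (- i))"
    using eqv_sym[OF tpow_cancel[of "- i"]] by (intro eqv_context) auto
  also have "\<dots> \<approx> expand [(i + 1, True), (i, True)]"
    using eqv_append[OF eqv_sym[OF next_letter] eqv_refl, of "expand_letter (i, True)"]
    by (simp add: expand_letter_def)
  finally show ?thesis by (simp add: line_eqv_def)
qed

definition line_inv :: "line_word \<Rightarrow> line_word" where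
  "line_inv u = rev (map (\<lambda>(i, e). (i, \<not> e)) u)"

lemma line_inv_simps [simp]:
  "line_inv [] = []" "line_inv (u @ v) = line_inv v @ line_inv u"
  by (auto simp: line_inv_def)

lemma line_eqv_inverse: "u @ line_inv u \<sim> []"
proof (induction u rule: rev_induct)
  case (snoc l u)
  obtain i e where l: "l = (i, e)" by force
  have "(u @ [l]) @ line_inv (u @ [l]) = u @ [(i, e), (i, \<not> e)] @ line_inv u"
    by (simp add: l line_inv_def)
  also have "\<dots> \<sim> u @ [] @ line_inv u" by (intro line_eqv_context line_eqv_cancel)
  also have "\<dots> \<sim> []" using snoc by simp
  finally show ?case .
qed simp

lemma line_inv_concat_replicate:
  "line_inv (concat (replicate j u)) = concat (replicate j (line_inv u))"
proof (induction j)
  case (Suc j)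
  have "concat (replicate j x) @ x = x @ concat (replicate j x)" for x :: line_word
    by (induction j) auto
  then show ?case using Suc by simp
qed simp

definition commute :: "line_word \<Rightarrow> line_word \<Rightarrow> bool" where
  "commute u v \<longleftrightarrow> u @ v \<sim> v @ u"

lemma commute_sym: "commute u v \<Longrightarrow> commute v u"
  unfolding commute_def by (rule line_eqv_sym)

lemma commute_append:
  assumes "commute u v" "commute u w"
  shows "commute u (v @ w)"
proof -
  have "u @ v @ w \<sim> v @ u @ w"
    using line_eqv_append[OF assms(1)[unfolded commute_def] line_eqv_refl[of w]] by simp
  also have "\<dots> \<sim> v @ w @ u"
    using line_eqv_append[OF line_eqv_refl[of v] assms(2)[unfolded commute_def]] by simp
  finally show ?thesis by (simp add: commute_def)
qed

lemma commute_replicate: "commute u [l] \<Longrightarrow> commute u (replicate n l)"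
proof (induction n)
  case (Suc n)
  then show ?case using commute_append[of u "[l]" "replicate n l"] by simp
qed (simp add: commute_def)

lemma commute_replicate2: "commute [k] [l] \<Longrightarrow> commute (replicate m k) (replicate n l)"
  by (metis commute_replicate commute_sym)

section \<open>From automata to submonoids\<close>

inductive run :: "('s \<times> line_word \<times> 's) set \<Rightarrow> 's \<Rightarrow> line_word \<Rightarrow> 's \<Rightarrow> bool"
  for E :: "('s \<times> line_word \<times> 's) set" where
  run_Nil: "run E p [] p"
| run_step: "(p, u, q) \<in> E \<Longrightarrow> run E q v r \<Longrightarrow> run E p (u @ v) r"

lemma run_append: "run E p u q \<Longrightarrow> run E q v r \<Longrightarrow> run E p (u @ v) r"
  by (induction rule: run.induct) (auto intro: run.intros)

lemma run_edge: "(p, u, q) \<in> E \<Longrightarrow> run E p u q"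
  using run_step[OF _ run_Nil] by fastforce

text \<open>Even indices from 4 on: no state letter is next to another one or to one of the letters
  -1, 0, 1, 2 that carry the computation, so that
  \<open>line_commute\<close> relates a state letter to none of them.\<close>

definition state_index :: "'s::countable \<Rightarrow> int" where
  "state_index p = 2 * int (to_nat p) + 4"

lemma state_index_eq [simp]: "state_index p = state_index q \<longleftrightarrow> p = q"
  by (simp add: state_index_def)

lemma state_index_props [simp]: "even (state_index p)" "state_index p \<ge> 4"
  by (simp_all add: state_index_def)

text \<open>If the labels of the edges are framed by the letters of their end points, then along a run
  the inner state letters cancel. Framed edge labels thus generate a submonoid that
  contains the framed label of every run.\<close>

definition framed :: "'s::countable \<Rightarrow> line_word \<Rightarrow> 's \<Rightarrow> line_word" where
  "framed p u q = (state_index p, True) # u @ [(state_index q, False)]"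

definition edge_word :: "'s::countable \<times> line_word \<times> 's \<Rightarrow> line_word" where
  "edge_word = (\<lambda>(p, u, q). framed p u q)"

lemma run_imp_product:
  assumes "run E p u q"
  shows "\<exists>es. set es \<subseteq> E \<and> framed p u q \<sim> concat (map edge_word es)"
  using assms
proof (induction rule: run.induct)
  case (run_Nil p)
  have "framed p [] p \<sim> []" using line_eqv_cancel[of _ True] by (simp add: framed_def)
  then show ?case by (intro exI[of _ "[]"]) simp
next
  case (run_step p u q v r)
  then obtain es where es: "set es \<subseteq> E" "framed q v r \<sim> concat (map edge_word es)" by blast
  have "framed p (u @ v) r = ((state_index p, True) # u) @ [] @ (v @ [(state_index r, False)])"
    by (simp add: framed_def)
  also have "\<dots> \<sim> ((state_index p, True) # u) @ [(state_index q, False), (state_index q, True)] @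
      (v @ [(state_index r, False)])"
    using line_eqv_sym[OF line_eqv_cancel[of "state_index q" False]] by (intro line_eqv_context) simp
  also have "\<dots> = framed p u q @ framed q v r" by (simp add: framed_def)
  also have "\<dots> \<sim> framed p u q @ concat (map edge_word es)"
    by (intro line_eqv_append line_eqv_refl es)
  finally show ?case using es run_step.hyps(1)
    by (intro exI[of _ "(p, u, q) # es"]) (auto simp: edge_word_def)
qed

section \<open>Actions of the group\<close>

text \<open>To prove that words are different in the group it suffices to let the group act. Permutations \<open>\<rho> i\<close>,
  for all integers \<open>i\<close>, of which neighbours commute, can be made into an action of the whole group: take
  copies of the set indexed by the integers, let \<open>t\<close> move to the next copy, and let \<open>a\<close> act on the copy
  \<open>k\<close> as \<open>\<rho> k\<close>. On the copy 0, the conjugate \<open>t\<^sup>i a t\<^sup>-\<^sup>i\<close> then acts as \<open>\<rho> i\<close>.\<close>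

locale line_action =
  fixes \<rho> \<rho>' :: "int \<Rightarrow> 'y \<Rightarrow> 'y"
  assumes inverse [simp]: "\<rho>' i (\<rho> i y) = y" "\<rho> i (\<rho>' i y) = y"
    and commute: "\<rho> i (\<rho> (i + 1) y) = \<rho> (i + 1) (\<rho> i y)"
begin

fun letter_act :: "nat + nat \<Rightarrow> int \<times> 'y \<Rightarrow> int \<times> 'y" where
  "letter_act (Inl x) (k, y) = (if x = 0 then (k, \<rho> k y) else (k + 1, y))"
| "letter_act (Inr x) (k, y) = (if x = 0 then (k, \<rho>' k y) else (k - 1, y))"

lemma fold_letter_act_eqv: "u \<approx> v \<Longrightarrow> fold letter_act u = fold letter_act v"
  unfolding eqv_def
proof (induction rule: pres_cong.induct)
  case (cancel l)
  have "letter_act (inv_letter l) (letter_act l z) = z" for z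
    by (cases l; cases z) (auto simp: inv_letter_def)
  then show ?case by auto
next
  case (relation u v)
  have "fold letter_act commutator_word z = z" for z
    by (cases z) (simp add: commutator_word_def flip: commute)
  then show ?case using relation by auto
qed auto

definition line_act :: "line_word \<Rightarrow> 'y \<Rightarrow> 'y" where
  "line_act = fold (\<lambda>(i, e). if e then \<rho> i else \<rho>' i)"

lemma line_act_simps [simp]:
  "line_act [] y = y" "line_act (u @ v) y = line_act v (line_act u y)"
  "line_act ((i, True) # u) y = line_act u (\<rho> i y)"
  "line_act ((i, False) # u) y = line_act u (\<rho>' i y)"
  by (simp_all add: line_act_def)

lemma fold_letter_act_tpow: "fold letter_act (tpow i) (k, y) = (k + i, y)"
proof -
  have "(letter_act (Inl 1) ^^ n) (k, y) = (k + int n, y)" for n by (induction n) auto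
  moreover have "(letter_act (Inr 1) ^^ n) (k, y) = (k - int n, y)" for n by (induction n) auto
  ultimately show ?thesis by (auto simp: tpow_def simp del: One_nat_def)
qed

lemma fold_letter_act_expand: "fold letter_act (expand u) (0, y) = (0, line_act u y)"
proof (induction u arbitrary: y)
  case (Cons l u)
  obtain i e where l: "l = (i, e)" by force
  then show ?case using Cons by (cases e) (simp_all add: expand_letter_def fold_letter_act_tpow)
qed simp

theorem line_act_eqv: "u \<sim> v \<Longrightarrow> line_act u y = line_act v y"
  using fold_letter_act_eqv[of "expand u" "expand v"] fold_letter_act_expand
  by (metis line_eqv_def prod.inject)

lemma line_act_inv [simp]: "line_act u (line_act (line_inv u) y) = y"
proof (induction u arbitrary: y rule: rev_induct)
  case (snoc l u)
  obtain i e where l: "l = (i, e)" by force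
  then show ?case using snoc by (cases e) (simp_all add: line_inv_def)
qed (simp add: line_inv_def)

end

section \<open>Separating automaton runs\<close>

text \<open>Infinitely many lines, indexed by integers, that are glued together at the hub; the argument \<open>n\<close> is the
  distance to the hub minus one. A state letter moves along its own line and fixes all others, so it permutes the
  positions. An edge label acts at the hub only. Standing one step before the hub on the line of a state
  \<open>p\<close> represents that an automaton is in state \<open>p\<close>.\<close>

datatype position = Hub | Before int nat | After int nat

fun forward :: "int \<Rightarrow> position \<Rightarrow> position" where
  "forward i Hub = After i 0"
| "forward i (Before j 0) = (if i = j then Hub else Before j 0)"
| "forward i (Before j (Suc n)) = (if i = j then Before j n else Before j (Suc n))"
| "forward i (After j n) = (if i = j then After j (Suc n) else After j n)"

fun backward :: "int \<Rightarrow> position \<Rightarrow> position" where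
  "backward i Hub = Before i 0"
| "backward i (After j 0) = (if i = j then Hub else After j 0)"
| "backward i (After j (Suc n)) = (if i = j then After j n else After j (Suc n))"
| "backward i (Before j n) = (if i = j then Before j (Suc n) else Before j n)"

lemma forward_Before: "forward i (Before j n) =
    (if i = j then case n of 0 \<Rightarrow> Hub | Suc m \<Rightarrow> Before j m else Before j n)"
  by (cases n) auto

lemma backward_After: "backward i (After j n) =
    (if i = j then case n of 0 \<Rightarrow> Hub | Suc m \<Rightarrow> After j m else After j n)"
  by (cases n) auto

lemma forward_backward [simp]: "forward i (backward i p) = p" "backward i (forward i p) = p"
  by (cases p; auto simp: forward_Before backward_After split: nat.split)+

text \<open>Four consecutive letters, so that \<open>a, b\<close> and \<open>b, c\<close> and \<open>c, d\<close> commute.\<close>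

abbreviation "a_letter \<equiv> (-1 :: int, True)"
abbreviation "b_letter \<equiv> (0 :: int, True)"
abbreviation "c_letter \<equiv> (1 :: int, True)"
abbreviation "d_letter \<equiv> (2 :: int, True)"

text \<open>Two stacks over a binary alphabet, written as numbers in base 3 with the digits 1 and 2: \<open>b\<close> and \<open>d\<close>
  push to the first, \<open>c\<close> and \<open>a\<close> to the second. Rational numbers make pushing invertible. Here \<open>a\<close> and \<open>d\<close>
  commute as well, but enough structure is left to recognize computations.\<close>

definition push :: "int \<Rightarrow> rat \<times> rat \<Rightarrow> rat \<times> rat" where
  "push i = (\<lambda>(x, y). if i = -1 then (x, 3 * y + 2) else if i = 0 then (3 * x + 1, y)
     else if i = 1 then (x, 3 * y + 1) else if i = 2 then (3 * x + 2, y) else (x, y))"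

definition pop :: "int \<Rightarrow> rat \<times> rat \<Rightarrow> rat \<times> rat" where
  "pop i = (\<lambda>(x, y). if i = -1 then (x, (y - 2) / 3) else if i = 0 then ((x - 1) / 3, y)
     else if i = 1 then (x, (y - 1) / 3) else if i = 2 then ((x - 2) / 3, y) else (x, y))"

lemma push_simps [simp]:
  "push (-1) (x, y) = (x, 3 * y + 2)" "push 0 (x, y) = (3 * x + 1, y)"
  "push 1 (x, y) = (x, 3 * y + 1)" "push 2 (x, y) = (3 * x + 2, y)"
  by (auto simp: push_def)

lemma push_other: "i \<notin> {-1, 0, 1, 2} \<Longrightarrow> push i z = z"
  by (auto simp: push_def)

lemma pop_simps [simp]:
  "pop (-1) (x, y) = (x, (y - 2) / 3)" "pop 0 (x, y) = ((x - 1) / 3, y)"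
  "pop 1 (x, y) = (x, (y - 1) / 3)" "pop 2 (x, y) = ((x - 2) / 3, y)"
  by (auto simp: pop_def)

lemma pop_other: "i \<notin> {-1, 0, 1, 2} \<Longrightarrow> pop i z = z"
  by (auto simp: pop_def)

lemma pop_push: "pop i (push i z) = z \<and> push i (pop i z) = z"
proof (cases "i \<in> {-1, 0, 1, 2}")
  case True
  obtain x y where z: "z = (x, y)" by (rule prod.exhaust)
  from True show ?thesis by (elim insertE emptyE) (simp_all add: z diff_divide_distrib)
qed (simp add: push_other pop_other del: insert_iff)

lemma push_commute: "push i (push (i + 1) z) = push (i + 1) (push i z)"
proof -
  obtain x y where z: "z = (x, y)" by (rule prod.exhaust)
  consider "i \<in> {-1, 0, 1}" | "i \<notin> {-1, 0, 1, 2}" | "i + 1 \<notin> {-1, 0, 1, 2}" by fastforce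
  then show ?thesis
  proof cases
    case 1
    then show ?thesis by (elim insertE emptyE) (simp_all add: z)
  qed (simp_all add: push_other del: insert_iff)
qed

interpretation stack: line_action push pop
  by unfold_locales (use pop_push push_commute in blast)+

definition hub_act :: "int \<Rightarrow> position \<times> rat \<times> rat \<Rightarrow> position \<times> rat \<times> rat" where
  "hub_act i = (\<lambda>(p, z). if even i \<and> i \<ge> 4 then (forward i p, z)
     else if p = Hub then (p, push i z) else (p, z))"

definition hub_act_inv :: "int \<Rightarrow> position \<times> rat \<times> rat \<Rightarrow> position \<times> rat \<times> rat" where
  "hub_act_inv i = (\<lambda>(p, z). if even i \<and> i \<ge> 4 then (backward i p, z)
     else if p = Hub then (p, pop i z) else (p, z))"

lemma push_high: "i > 2 \<Longrightarrow> push i z = z"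
  by (simp add: push_other)

lemma hub_act_chain: "even i \<Longrightarrow> i \<ge> 4 \<Longrightarrow> hub_act i (p, z) = (forward i p, z)"
  and hub_act_inv_chain: "even i \<Longrightarrow> i \<ge> 4 \<Longrightarrow> hub_act_inv i (p, z) = (backward i p, z)"
  and hub_act_stack: "odd i \<or> i < 4 \<Longrightarrow> hub_act i (p, z) = (p, if p = Hub then push i z else z)"
  and hub_act_inv_stack: "odd i \<or> i < 4 \<Longrightarrow> hub_act_inv i (p, z) = (p, if p = Hub then pop i z else z)"
  by (auto simp: hub_act_def hub_act_inv_def)

lemma hub_act_fixed: "odd i \<Longrightarrow> i \<ge> 3 \<Longrightarrow> hub_act i z = z"
  by (cases z) (simp add: hub_act_stack push_high)

lemma hub_act_commute: "hub_act i (hub_act (i + 1) z) = hub_act (i + 1) (hub_act i z)"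
proof -
  obtain p y where z: "z = (p, y)" by (rule prod.exhaust)
  show ?thesis
  proof (cases "i \<ge> 3")
    case True
    then show ?thesis by (cases "even i") (simp_all add: hub_act_fixed)
  next
    case False
    then have "odd i \<or> i < 4" "odd (i + 1) \<or> i + 1 < 4" by simp_all
    note stack_letters = this[THEN hub_act_stack]
    show ?thesis using stack.commute[of i y] by (simp add: z stack_letters)
  qed
qed

lemma hub_act_inverse: "hub_act_inv i (hub_act i z) = z" "hub_act i (hub_act_inv i z) = z"
  unfolding hub_act_def hub_act_inv_def
  by (cases z; simp add: pop_push)+

interpretation hub: line_action hub_act hub_act_inv
  by unfold_locales (fact hub_act_inverse hub_act_commute)+

definition low_word :: "line_word \<Rightarrow> bool" where
  "low_word u \<longleftrightarrow> (\<forall>l\<in>set u. fst l < 4)"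

lemma low_word_simps [simp]:
  "low_word []" "low_word (l # u) \<longleftrightarrow> fst l < 4 \<and> low_word u"
  "low_word (u @ v) \<longleftrightarrow> low_word u \<and> low_word v"
  by (auto simp: low_word_def)

lemma hub_act_low: "low_word u \<Longrightarrow>
    hub.line_act u (p, z) = (p, if p = Hub then stack.line_act u z else z)"
proof (induction u arbitrary: z)
  case (Cons l u)
  obtain i e where l: "l = (i, e)" by force
  then show ?case using Cons by (cases e) (simp_all add: hub_act_stack hub_act_inv_stack)
qed simp

text \<open>The letter of \<open>p\<close> moves a point in front of the hub into the hub only from the last place on the line
  of \<open>p\<close>. In all other cases \<open>u\<close> has no effect, and the point stays in front of the hub on its line.\<close>

lemma hub_act_framed:
  assumes "low_word u"
  shows "hub.line_act (framed p u q) (Before (state_index r) n, z) =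
    (if r = p \<and> n = 0 then (Before (state_index q) 0, stack.line_act u z)
     else (Before (state_index r) (if r = p then if r = q then n else n - 1
       else if r = q then Suc n else n), z))"
  using assms
  by (auto simp: framed_def hub_act_chain hub_act_inv_chain hub_act_low forward_Before split: nat.split)

text \<open>An arbitrary product of framed edge labels may contain factors that do not fit together. Their only
  effect is to move back and forth on the line of the current state; the factors that do reach
  the hub form a run.\<close>

lemma product_imp_run:
  assumes E: "\<forall>(p, u, q)\<in>E. low_word u" and es: "set es \<subseteq> E"
    and z: "hub.line_act (concat (map edge_word es)) (Before (state_index p) 0, z) =
      (Before (state_index q) 0, z')"
  shows "\<exists>u. run E p u q \<and> stack.line_act u z = z'"
proof -
  have "\<exists>r n u. hub.line_act (concat (map edge_word es)) (Before (state_index p) 0, z) =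
      (Before (state_index r) n, stack.line_act u z) \<and> run E p u r"
    using es
  proof (induction es rule: rev_induct)
    case Nil
    then show ?case using run_Nil[of E p]
      by (intro exI[of _ p] exI[of _ 0] exI[of _ "[]"]) simp
  next
    case (snoc e es)
    obtain p' w q' where e: "e = (p', w, q')" by (cases e)
    then have w: "low_word w" "(p', w, q') \<in> E" using snoc.prems E by auto
    have "set es \<subseteq> E" using snoc.prems by simp
    from snoc.IH[OF this] obtain r n u where IH: "run E p u r"
      "hub.line_act (concat (map edge_word es)) (Before (state_index p) 0, z) =
        (Before (state_index r) n, stack.line_act u z)" by (elim exE conjE)
    have eq: "hub.line_act (concat (map edge_word (es @ [e]))) (Before (state_index p) 0, z) =
        hub.line_act (framed p' w q') (Before (state_index r) n, stack.line_act u z)"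
      using IH(2) by (simp add: e edge_word_def)
    show ?case
    proof (cases "r = p' \<and> n = 0")
      case True
      then have "run E p (u @ w) q'" using run_append[OF IH(1)] run_edge w(2) by metis
      then show ?thesis unfolding eq hub_act_framed[OF w(1)] using True
        by (intro exI[of _ q'] exI[of _ 0] exI[of _ "u @ w"]) simp
    next
      case False
      then obtain n' where "hub.line_act (framed p' w q') (Before (state_index r) n, stack.line_act u z) =
          (Before (state_index r) n', stack.line_act u z)"
        unfolding hub_act_framed[OF w(1)] by simp
      then show ?thesis using IH(1) eq by (intro exI[of _ r] exI[of _ n'] exI[of _ u]) simp
    qed
  qed
  then obtain r n u where "hub.line_act (concat (map edge_word es)) (Before (state_index p) 0, z) =
      (Before (state_index r) n, stack.line_act u z)" "run E p u r" by (elim exE conjE)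
  then show ?thesis using z by (intro exI[of _ u]) simp
qed

lemma framed_is_product_if_run:
  assumes "run E p u q" "u \<sim> w"
  shows "\<exists>es. set es \<subseteq> E \<and> framed p w q \<sim> concat (map edge_word es)"
proof -
  obtain es where es: "set es \<subseteq> E" "framed p u q \<sim> concat (map edge_word es)"
    using run_imp_product[OF assms(1)] by blast
  have "framed p w q \<sim> framed p u q" unfolding framed_def
    using line_eqv_context[OF line_eqv_sym[OF assms(2)], of "[(state_index p, True)]"] by simp
  also note es(2)
  finally show ?thesis using es(1) by blast
qed

lemma run_if_framed_is_product:
  assumes E: "\<forall>(p, u, q)\<in>E. low_word u" and w: "low_word w"
    and es: "set es \<subseteq> E" "framed p w q \<sim> concat (map edge_word es)"
  shows "\<exists>u. run E p u q \<and> stack.line_act u z = stack.line_act w z"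
proof -
  have "hub.line_act (concat (map edge_word es)) (Before (state_index p) 0, z) =
      (Before (state_index q) 0, stack.line_act w z)"
    using hub_act_framed[OF w, of p q p 0 z] hub.line_act_eqv[OF es(2)] by simp
  then show ?thesis using product_imp_run[OF E es(1)] by blast
qed

section \<open>The automaton of a program\<close>

instance prog :: countable
  by countable_datatype

text \<open>In the state \<open>At k\<close> the programs in the list \<open>k\<close> remain to be executed one after
  the other. A state \<open>Inside\<close> belongs to a primitive step that is followed by \<open>k\<close>.\<close>

datatype state = Guess | Start | At "prog list" | Inside nat nat nat nat "prog list"

instance state :: countable
  by countable_datatype

abbreviation B :: "nat \<Rightarrow> line_word" where "B n \<equiv> replicate n b_letter"
abbreviation C :: "nat \<Rightarrow> line_word" where "C n \<equiv> replicate n c_letter"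

type_synonym edge = "state \<times> line_word \<times> state"

text \<open>A run first multiplies, without any control, some word in \<open>b c\<close> and \<open>d a\<close>. It is a guess of the whole
  computation: \<open>(b c)\<^sup>n\<close> for each number \<open>n\<close> that occurs, and \<open>d a\<close> as a separator. The last edge
  leads to the end of the program, since the computation is checked backwards.\<close>

definition guess_edges :: "edge set" where
  "guess_edges = {(Guess, [b_letter, c_letter], Guess), (Guess, [d_letter, a_letter], Guess),
    (Guess, [d_letter], At [])}"

text \<open>These edges go against the direction of execution, and their labels are inverse: they remove, from
  the right end of the guess, the word \<open>c\<^sup>n b\<^sup>m a d\<close> for each primitive step from \<open>n = p * j + r\<close>
  to \<open>m = q * j + s\<close>. The loop at \<open>Inside\<close> is traversed \<open>j\<close> times. Edges with empty label unfold
  the other program constructors. The recursion meets each subprogram once, so there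
  are finitely many edges.\<close>

primrec prog_edges :: "prog \<Rightarrow> prog list \<Rightarrow> edge set" where
  "prog_edges (Lin p r q s) k =
    {(At k, line_inv [a_letter, d_letter], Inside p r q s k),
     (Inside p r q s k, line_inv (C p @ B q), Inside p r q s k),
     (Inside p r q s k, line_inv (C r @ B s), At (Lin p r q s # k))}"
| "prog_edges (Seq e1 e2) k = {(At (e1 # e2 # k), [], At (Seq e1 e2 # k))} \<union>
    prog_edges e1 (e2 # k) \<union> prog_edges e2 k"
| "prog_edges (Alt e1 e2) k =
    {(At (e1 # k), [], At (Alt e1 e2 # k)), (At (e2 # k), [], At (Alt e1 e2 # k))} \<union>
    prog_edges e1 k \<union> prog_edges e2 k"
| "prog_edges (Iter e) k =
    {(At k, [], At (Iter e # k)), (At (e # Iter e # k), [], At (Iter e # k))} \<union>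
    prog_edges e (Iter e # k)"

definition edges :: "prog \<Rightarrow> edge set" where
  "edges e = guess_edges \<union> {(At [e], [], Start)} \<union> prog_edges e []"

lemma finite_edges: "finite (edges e)"
proof -
  have "finite (prog_edges e k)" for k by (induction e arbitrary: k) auto
  then show ?thesis by (simp add: edges_def guess_edges_def)
qed

lemma low_word_inv: "low_word u \<Longrightarrow> low_word (line_inv u)"
  by (auto simp: low_word_def line_inv_def)

lemma low_word_replicate [simp]: "low_word (replicate n (i, e)) \<longleftrightarrow> n = 0 \<or> i < 4"
  by (auto simp: low_word_def)

lemma low_word_edges: "\<forall>(p, u, q)\<in>edges e. low_word u"
proof -
  have "(p, u, q) \<in> prog_edges e k \<Longrightarrow> low_word u" for p u q k
    by (induction e arbitrary: k) (auto intro!: low_word_inv simp del: line_inv_simps(2))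
  then show ?thesis by (auto simp: edges_def guess_edges_def)
qed

section \<open>Computations give factorizations\<close>

lemma commute_bc: "commute (B m) (C n)" and commute_cd: "commute (C n) [d_letter]"
  and commute_ab: "commute [a_letter] (B m)"
proof -
  have bc: "commute [b_letter] [c_letter]" and cd: "commute [c_letter] [d_letter]"
    and ab: "commute [a_letter] [b_letter]"
    using line_commute[of 0] line_commute[of 1] line_commute[of "-1"] by (simp_all add: commute_def)
  show "commute (B m) (C n)" by (rule commute_replicate2[OF bc])
  show "commute (C n) [d_letter]" using commute_replicate2[OF cd, of n 1] by simp
  show "commute [a_letter] (B m)" by (rule commute_replicate[OF ab])
qed

lemma bc_blocks: "concat (replicate j (C p @ B q)) \<sim> C (p * j) @ B (q * j)"
proof (induction j)
  case (Suc j)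
  have "concat (replicate (Suc j) (C p @ B q)) \<sim> C p @ (B q @ C (p * j)) @ B (q * j)"
    using line_eqv_append[OF line_eqv_refl Suc, of "C p @ B q"] by simp
  also have "\<dots> \<sim> C p @ (C (p * j) @ B q) @ B (q * j)"
    by (rule line_eqv_context[OF commute_bc[unfolded commute_def]])
  also have "\<dots> = C (p * Suc j) @ B (q * Suc j)" by (simp add: replicate_add)
  finally show ?case .
qed simp

lemma guess_block: "concat (replicate n [b_letter, c_letter]) \<sim> B n @ C n"
proof -
  have "[b_letter, c_letter] \<sim> C 1 @ B 1" using commute_bc[of 1 1] by (simp add: commute_def)
  then have "concat (replicate n [b_letter, c_letter]) \<sim> concat (replicate n (C 1 @ B 1))"
    by (induction n) (auto dest: line_eqv_append)
  also have "\<dots> \<sim> C n @ B n" using bc_blocks[of n 1 1] by simp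
  also have "\<dots> \<sim> B n @ C n" using commute_bc[of n n] by (simp add: commute_def line_eqv_sym)
  finally show ?thesis .
qed

lemma transfer_block: "C r @ B s @ concat (replicate j (C p @ B q)) \<sim> C (p * j + r) @ B (q * j + s)"
proof -
  have "C r @ B s @ concat (replicate j (C p @ B q)) \<sim> C r @ (B s @ C (p * j)) @ B (q * j)"
    using line_eqv_append[OF line_eqv_refl bc_blocks, of "C r @ B s"] by simp
  also have "\<dots> \<sim> C r @ (C (p * j) @ B s) @ B (q * j)"
    by (rule line_eqv_context[OF commute_bc[unfolded commute_def]])
  also have "\<dots> = C (p * j + r) @ B (q * j + s)"
    by (simp add: add.commute[of "p * j"] add.commute[of "q * j"] replicate_add)
  finally show ?thesis .
qed

text \<open>The identity on which the simulation rests. The left side writes \<open>n\<close> twice in parallel, as powers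
  of \<open>b\<close> and of \<open>c\<close>. Moving \<open>c\<^sup>n\<close> past \<open>d\<close> and \<open>a\<close> past \<open>b\<^sup>n\<^sup>'\<close> brings \<open>c\<^sup>n\<close> next to the number
  \<open>n'\<close> that follows, where an automaton can check the relation between \<open>n\<close> and \<open>n'\<close>.\<close>

lemma step_identity:
  assumes "n = p * j + r" "n' = q * j + s"
  shows "concat (replicate n [b_letter, c_letter]) @ [d_letter, a_letter] @ B n' @ [d_letter] \<sim>
    B n @ [d_letter] @ C r @ B s @ concat (replicate j (C p @ B q)) @ [a_letter, d_letter]"
proof -
  have "concat (replicate n [b_letter, c_letter]) @ [d_letter, a_letter] @ B n' @ [d_letter] \<sim>
      B n @ (C n @ [d_letter]) @ ([a_letter] @ B n' @ [d_letter])"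
    using line_eqv_append[OF guess_block line_eqv_refl] by simp
  also have "\<dots> \<sim> B n @ ([d_letter] @ C n) @ ([a_letter] @ B n' @ [d_letter])"
    by (rule line_eqv_context[OF commute_cd[unfolded commute_def]])
  also have "\<dots> = (B n @ [d_letter] @ C n) @ ([a_letter] @ B n') @ [d_letter]" by simp
  also have "\<dots> \<sim> (B n @ [d_letter] @ C n) @ (B n' @ [a_letter]) @ [d_letter]"
    by (rule line_eqv_context[OF commute_ab[unfolded commute_def]])
  also have "\<dots> = (B n @ [d_letter]) @ (C n @ B n') @ [a_letter, d_letter]" by simp
  also have "\<dots> \<sim> (B n @ [d_letter]) @ (C r @ B s @ concat (replicate j (C p @ B q))) @ [a_letter, d_letter]"
    unfolding assms by (rule line_eqv_context[OF line_eqv_sym[OF transfer_block]])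
  finally show ?thesis by simp
qed

text \<open>The pair of a remaining program \<open>k\<close> and a number \<open>n\<close> has been reached in a computation that started at
  \<open>N\<close>: a guess \<open>u\<close> followed by \<open>b\<^sup>n d\<close> is reduced to the initial \<open>b\<^sup>N d\<close> by a checking run \<open>v\<close>.\<close>

definition simulated :: "edge set \<Rightarrow> nat \<Rightarrow> prog list \<Rightarrow> nat \<Rightarrow> bool" where
  "simulated E N k n \<longleftrightarrow> (\<exists>u v. run E Guess u Guess \<and> run E (At k) v Start \<and>
     u @ B n @ [d_letter] @ v \<sim> B N @ [d_letter])"

lemma simulated_silent:
  "simulated E N k n \<Longrightarrow> (At k', [], At k) \<in> E \<Longrightarrow> simulated E N k' n"
  unfolding simulated_def using run_step by fastforce

lemma run_loop: "(p, u, p) \<in> E \<Longrightarrow> run E p (concat (replicate n u)) p"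
  by (induction n) (auto intro: run.intros)

lemma simulated_Lin:
  assumes sim: "simulated E N (Lin p r q s # k) (p * j + r)"
    and E: "guess_edges \<subseteq> E" "prog_edges (Lin p r q s) k \<subseteq> E"
  shows "simulated E N k (q * j + s)"
proof -
  define n n' where "n = p * j + r" and "n' = q * j + s"
  define F where "F = C r @ B s @ concat (replicate j (C p @ B q)) @ [a_letter, d_letter]"
  define K where "K = concat (replicate n [b_letter, c_letter]) @ [d_letter, a_letter]"
  obtain u v where u: "run E Guess u Guess" and v: "run E (At (Lin p r q s # k)) v Start"
    and uv: "u @ B n @ [d_letter] @ v \<sim> B N @ [d_letter]"
    using sim unfolding simulated_def n_def by blast
  have "run E Guess K Guess"
    unfolding K_def using E(1) by (intro run_append[OF run_loop run_edge]) (auto simp: guess_edges_def)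
  with u have 1: "run E Guess (u @ K) Guess" by (rule run_append)
  have "run E (At k) (line_inv [a_letter, d_letter] @ concat (replicate j (line_inv (C p @ B q))) @
      line_inv (C r @ B s) @ v) Start"
    using E(2) by (intro run_append[OF run_edge] run_append[OF run_loop] run_append[OF run_edge v]) auto
  then have 2: "run E (At k) (line_inv F @ v) Start"
    by (simp add: F_def line_inv_concat_replicate)
  have "(u @ K) @ B n' @ [d_letter] @ line_inv F @ v \<sim> u @ (B n @ [d_letter] @ F) @ (line_inv F @ v)"
    using line_eqv_context[OF step_identity[OF n_def n'_def], of u "line_inv F @ v"]
    by (simp add: K_def F_def)
  also have "\<dots> = (u @ B n @ [d_letter]) @ (F @ line_inv F) @ v" by simp
  also have "\<dots> \<sim> (u @ B n @ [d_letter]) @ [] @ v" by (intro line_eqv_context line_eqv_inverse)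
  also have "\<dots> \<sim> B N @ [d_letter]" using uv by simp
  finally show ?thesis unfolding simulated_def n'_def[symmetric] using 1 2 by blast
qed

lemma simulated_sem:
  assumes "(x, y) \<in> sem e" "simulated E N (e # k) x" "guess_edges \<subseteq> E" "prog_edges e k \<subseteq> E"
  shows "simulated E N k y"
  using assms
proof (induction e arbitrary: k x y)
  case (Lin p r q s)
  then show ?case using simulated_Lin by auto
next
  case (Seq e1 e2)
  from Seq.prems(1) obtain z where z: "(x, z) \<in> sem e1" "(z, y) \<in> sem e2" by auto
  have "simulated E N (e1 # e2 # k) x" using Seq.prems by (auto intro: simulated_silent)
  then have "simulated E N (e2 # k) z" using Seq.prems by (intro Seq.IH(1)[OF z(1)]) auto
  then show ?case using Seq.prems by (intro Seq.IH(2)[OF z(2)]) auto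
next
  case (Alt e1 e2)
  from Alt.prems(1) consider "(x, y) \<in> sem e1" | "(x, y) \<in> sem e2" by auto
  then show ?case
  proof cases
    case 1
    have "simulated E N (e1 # k) x" using Alt.prems by (auto intro: simulated_silent)
    then show ?thesis using Alt.prems by (intro Alt.IH(1)[OF 1]) auto
  next
    case 2
    have "simulated E N (e2 # k) x" using Alt.prems by (auto intro: simulated_silent)
    then show ?thesis using Alt.prems by (intro Alt.IH(2)[OF 2]) auto
  qed
next
  case (Iter e)
  from Iter.prems(1) have "(x, y) \<in> (sem e)\<^sup>*" by simp
  then have "simulated E N (Iter e # k) y"
  proof (induction rule: rtrancl_induct)
    case (step y z)
    have "simulated E N (e # Iter e # k) y" using step.IH Iter.prems by (auto intro: simulated_silent)
    then show ?case using Iter.prems by (intro Iter.IH[OF step.hyps(2)]) auto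
  qed (use Iter.prems in simp)
  then show ?case using Iter.prems by (auto intro: simulated_silent)
qed

theorem accepting_run:
  assumes "(N, 0) \<in> sem e"
  shows "\<exists>u. run (edges e) Guess u Start \<and> u \<sim> B N @ [d_letter]"
proof -
  have "run (edges e) (At [e]) [] Start" by (rule run_edge) (simp add: edges_def)
  then have "simulated (edges e) N [e] N" unfolding simulated_def
    by (intro exI[of _ "[]"]) (auto intro: run_Nil)
  then have "simulated (edges e) N [] 0"
    by (rule simulated_sem[OF assms]) (auto simp: edges_def)
  then obtain u v where u: "run (edges e) Guess u Guess" and v: "run (edges e) (At []) v Start"
    and uv: "u @ [d_letter] @ v \<sim> B N @ [d_letter]" unfolding simulated_def by auto
  have "run (edges e) Guess [d_letter] (At [])"
    by (rule run_edge) (simp add: edges_def guess_edges_def)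
  then show ?thesis using run_append[OF u run_append[OF _ v]] uv by blast
qed

section \<open>Factorizations come from computations\<close>

primrec bin :: "bool list \<Rightarrow> rat" where
  "bin [] = 0"
| "bin (x # xs) = 3 * bin xs + (if x then 2 else 1)"

lemma bin_inject [simp]: "bin xs = bin ys \<longleftrightarrow> xs = ys"
proof -
  define nbin :: "bool list \<Rightarrow> nat" where
    "nbin = rec_list 0 (\<lambda>x xs r. 3 * r + (if x then 2 else 1))"
  have [simp]: "nbin [] = 0" "nbin (x # xs) = 3 * nbin xs + (if x then 2 else 1)" for x xs
    by (simp_all add: nbin_def)
  have eq: "bin xs = of_nat (nbin xs)" for xs by (induction xs) auto
  have "nbin xs = nbin ys \<Longrightarrow> xs = ys"
  proof (induction xs arbitrary: ys)
    case Nil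
    then show ?case by (cases ys) (auto split: if_splits)
  next
    case (Cons x xs)
    then obtain y ys' where ys: "ys = y # ys'" by (cases ys) (auto split: if_splits)
    with Cons.prems have "3 * nbin xs + (if x then 2 else 1) = 3 * nbin ys' + (if y then 2 else 1)"
      by simp
    then have "x = y" "nbin xs = nbin ys'" by (cases x; cases y; presburger)+
    then show ?case using Cons.IH ys by simp
  qed
  then show ?thesis by (auto simp: eq)
qed

abbreviation blank :: "nat \<Rightarrow> bool list" where "blank n \<equiv> replicate n False"

definition bottomed :: "bool list \<Rightarrow> bool" where
  "bottomed S \<longleftrightarrow> S = [] \<or> hd S"

lemma bottomed_simps [simp]: "bottomed []" "bottomed (x # S) \<longleftrightarrow> x"
  by (auto simp: bottomed_def)

text \<open>A number on a stack is delimited by the next \<open>True\<close> or by the bottom, so it can be read off.\<close>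

lemma blank_append_eq_iff:
  assumes "bottomed X" "bottomed S"
  shows "blank n @ X = blank m @ S \<longleftrightarrow> n = m \<and> X = S"
proof
  assume "blank n @ X = blank m @ S"
  then show "n = m \<and> X = S"
  proof (induction n arbitrary: m)
    case 0
    then show ?case using assms by (cases m) auto
  next
    case (Suc n)
    then show ?case using assms by (cases m) auto
  qed
qed simp

lemma stack_act_B [simp]: "stack.line_act (B n) (bin S, y) = (bin (blank n @ S), y)"
proof (induction n arbitrary: S)
  case (Suc n)
  from Suc[of "False # S"] show ?case by (simp add: replicate_app_Cons_same)
qed simp

lemma stack_act_C [simp]: "stack.line_act (C n) (x, bin S) = (x, bin (blank n @ S))"
proof (induction n arbitrary: S)
  case (Suc n)
  from Suc[of "False # S"] show ?case by (simp add: replicate_app_Cons_same)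
qed simp

text \<open>The relation that remains to be executed at \<open>At k\<close>.\<close>

primrec continuation :: "prog list \<Rightarrow> (nat \<times> nat) set" where
  "continuation [] = Id"
| "continuation (e # k) = sem e O continuation k"

text \<open>The shapes of edges that occur for some program. For edges with empty label, only
  the inclusion of the remaining relations matters.\<close>

inductive_set machine_edges :: "edge set" where
  enter: "(At k, line_inv [a_letter, d_letter], Inside p r q s k) \<in> machine_edges"
| loop: "(Inside p r q s k, line_inv (C p @ B q), Inside p r q s k) \<in> machine_edges"
| leave: "(Inside p r q s k, line_inv (C r @ B s), At (Lin p r q s # k)) \<in> machine_edges"
| silent: "continuation k' \<subseteq> continuation k \<Longrightarrow> (At k', [], At k) \<in> machine_edges"

lemma prog_edges_subset: "prog_edges e k \<subseteq> machine_edges"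
proof (induction e arbitrary: k)
  case (Lin p r q s)
  then show ?case by (auto intro: machine_edges.intros simp del: line_inv_simps)
next
  case (Iter e)
  have "continuation k \<subseteq> continuation (Iter e # k)" by auto
  moreover have "continuation (e # Iter e # k) \<subseteq> continuation (Iter e # k)"
    by (auto intro: converse_rtrancl_into_rtrancl)
  ultimately show ?case using Iter by (auto intro: machine_edges.silent simp del: continuation.simps)
next
  case (Seq e1 e2)
  have "continuation (e1 # e2 # k) \<subseteq> continuation (Seq e1 e2 # k)" by auto
  then show ?case using Seq by (auto intro: machine_edges.silent simp del: continuation.simps)
next
  case (Alt e1 e2)
  have "continuation (e1 # k) \<subseteq> continuation (Alt e1 e2 # k)"
    "continuation (e2 # k) \<subseteq> continuation (Alt e1 e2 # k)" by auto
  then show ?case using Alt by (auto intro: machine_edges.silent simp del: continuation.simps)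
qed

text \<open>Where checking has undone the computation only in part, the first stack shows \<open>d b\<^sup>n\<close> above some \<open>X\<close>.
  Every block of the first stack has been related to one block of the second stack by a primitive step.
  If the rest \<open>X\<close> agrees with the second stack, which the guessing part will enforce, then
  these steps compose, and \<open>n\<close> has been reached from \<open>N\<close> with \<open>k\<close> left to execute. Only acceptance with
  final number \<open>0\<close> needs to be recorded.\<close>

definition consistent :: "prog \<Rightarrow> nat \<Rightarrow> prog list \<Rightarrow> bool list \<Rightarrow> bool list \<Rightarrow> bool" where
  "consistent e N k S1 S2 \<longleftrightarrow> (\<exists>n X. S1 = True # blank n @ X \<and> bottomed X \<and> bottomed S2 \<and>
     (X = S2 \<longrightarrow> (n, 0) \<in> continuation k \<longrightarrow> (N, 0) \<in> sem e))"

primrec state_inv :: "prog \<Rightarrow> nat \<Rightarrow> state \<Rightarrow> rat \<times> rat \<Rightarrow> bool" where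
  "state_inv e N Guess z \<longleftrightarrow> True"
| "state_inv e N Start z \<longleftrightarrow> z = (bin (True # blank N), bin [])"
| "state_inv e N (At k) z \<longleftrightarrow> (\<exists>S1 S2. z = (bin S1, bin S2) \<and> consistent e N k S1 S2)"
| "state_inv e N (Inside p r q s k) z \<longleftrightarrow> (\<exists>S1 S2 j.
     z = (bin (blank (q * j + s) @ S1), bin (blank (p * j + r) @ S2)) \<and>
     consistent e N (Lin p r q s # k) S1 S2)"

lemma stack_act_inv_eq: "stack.line_act (line_inv u) z = z' \<Longrightarrow> z = stack.line_act u z'"
  by auto

text \<open>Read against the direction of the edges, the run pushes the blocks of a computation. When
  a step is complete, the new rest of the first stack is \<open>d b\<^sup>n X\<close> and the second stack has received
  \<open>a c\<^sup>m\<close>. They agree only if \<open>n = m\<close> and the older parts agree, so the old consistency applies.\<close>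

lemma state_inv_machine_edge:
  assumes "(x, u, y) \<in> machine_edges" "state_inv e N y (stack.line_act u z)"
  shows "state_inv e N x z"
  using assms
proof cases
  case (enter k p r q s)
  from assms(2) obtain S1 S2 j where
    z: "stack.line_act (line_inv [a_letter, d_letter]) z =
      (bin (blank (q * j + s) @ S1), bin (blank (p * j + r) @ S2))"
    and con: "consistent e N (Lin p r q s # k) S1 S2"
    unfolding enter state_inv.simps by blast
  from con obtain n X where S: "S1 = True # blank n @ X" "bottomed X" "bottomed S2"
    and impl: "X = S2 \<Longrightarrow> (n, 0) \<in> continuation (Lin p r q s # k) \<Longrightarrow> (N, 0) \<in> sem e"
    unfolding consistent_def by blast
  have "(N, 0) \<in> sem e" if "S1 = True # blank (p * j + r) @ S2" "(q * j + s, 0) \<in> continuation k"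
  proof -
    have "n = p * j + r" "X = S2" using that(1) S blank_append_eq_iff by auto
    then show ?thesis using impl that(2) by auto
  qed
  then have "consistent e N k (True # blank (q * j + s) @ S1) (True # blank (p * j + r) @ S2)"
    unfolding consistent_def using S(1)
    by (intro exI[of _ "q * j + s"] exI[of _ S1]) simp
  moreover have "z = (bin (True # blank (q * j + s) @ S1), bin (True # blank (p * j + r) @ S2))"
    using stack_act_inv_eq[OF z] by simp
  ultimately show ?thesis unfolding enter state_inv.simps by blast
next
  case (loop p r q s k)
  from assms(2) obtain S1 S2 j where
    z: "stack.line_act (line_inv (C p @ B q)) z =
      (bin (blank (q * j + s) @ S1), bin (blank (p * j + r) @ S2))"
    and con: "consistent e N (Lin p r q s # k) S1 S2"
    unfolding loop state_inv.simps by blast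
  have "z = (bin (blank (q * Suc j + s) @ S1), bin (blank (p * Suc j + r) @ S2))"
    using stack_act_inv_eq[OF z] by (simp add: replicate_add)
  then show ?thesis unfolding loop state_inv.simps using con by blast
next
  case (leave p r q s k)
  from assms(2) obtain S1 S2 where
    z: "stack.line_act (line_inv (C r @ B s)) z = (bin S1, bin S2)"
    and con: "consistent e N (Lin p r q s # k) S1 S2"
    unfolding leave state_inv.simps by blast
  have "z = (bin (blank (q * 0 + s) @ S1), bin (blank (p * 0 + r) @ S2))"
    using stack_act_inv_eq[OF z] by simp
  then show ?thesis unfolding leave state_inv.simps using con by blast
next
  case (silent k' k)
  then show ?thesis using assms(2) unfolding silent state_inv.simps consistent_def
    by (metis stack.line_act_simps(1) subsetD)
qed

lemma run_state_inv:
  assumes "run (edges e) p u q" "q = Start" "stack.line_act u z = (bin (True # blank N), bin [])"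
  shows "state_inv e N p z"
  using assms
proof (induction arbitrary: z rule: run.induct)
  case (run_step p u q v r)
  have IH: "state_inv e N q (stack.line_act u z)" using run_step by simp
  from run_step.hyps(1) consider "p = Guess" | "p = At [e]" "u = []" "q = Start"
    | "(p, u, q) \<in> machine_edges"
    using prog_edges_subset unfolding edges_def guess_edges_def by blast
  then show ?case
  proof cases
    case 2
    then have z: "z = (bin (True # blank N), bin [])" using IH by simp
    have "consistent e N [e] (True # blank N) []"
      unfolding consistent_def by (intro exI[of _ N] exI[of _ "[]"]) simp
    then show ?thesis unfolding 2 z state_inv.simps by blast
  next
    case 3
    then show ?thesis using state_inv_machine_edge IH by blast
  qed simp
qed simp

text \<open>Guessing pushes the same digits to both stacks, so before checking they show \<open>d W\<close> and \<open>W\<close>. Since \<open>W\<close>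
  is empty or begins with a separator, the block on top of the first stack is empty: the
  final number is \<open>0\<close>, and the agreement that \<open>consistent\<close> asks for holds.\<close>

lemma run_from_Guess:
  assumes "run (edges e) p u q" "p = Guess" "q = Start"
    "stack.line_act u (bin W, bin W) = (bin (True # blank N), bin [])"
  shows "(N, 0) \<in> sem e"
  using assms
proof (induction arbitrary: W rule: run.induct)
  case (run_step p u q v r)
  have edge: "(p, u, q) \<in> guess_edges"
  proof -
    have "x \<noteq> Guess" if "(x, w, y) \<in> machine_edges" for x w y
      using that by cases auto
    then show ?thesis
      using run_step.hyps(1) run_step.prems(1) prog_edges_subset unfolding edges_def by blast
  qed
  then consider "u = [b_letter, c_letter]" "q = Guess" | "u = [d_letter, a_letter]" "q = Guess"
    | "u = [d_letter]" "q = At []" unfolding guess_edges_def by blast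
  then show ?case
  proof cases
    case 1
    then show ?thesis using run_step.IH[of "False # W"] run_step.prems by simp
  next
    case 2
    then show ?thesis using run_step.IH[of "True # W"] run_step.prems by simp
  next
    case 3
    then have "state_inv e N (At []) (bin (True # W), bin W)"
      using run_state_inv[OF run_step.hyps(2) run_step.prems(2), of "(bin (True # W), bin W)"]
        run_step.prems(3) by simp
    then obtain n X where "True # W = True # blank n @ X" "bottomed X" "bottomed W"
      and impl: "X = W \<Longrightarrow> (n, 0) \<in> continuation [] \<Longrightarrow> (N, 0) \<in> sem e"
      unfolding state_inv.simps consistent_def prod.inject bin_inject by blast
    then have "n = 0 \<and> X = W" using blank_append_eq_iff[of X W n 0] by auto
    then show ?thesis using impl by simp
  qed
qed simp

theorem accepting_run_imp_sem:
  assumes "run (edges e) Guess u Start" "stack.line_act u (0, 0) = stack.line_act (B N @ [d_letter]) (0, 0)"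
  shows "(N, 0) \<in> sem e"
proof (rule run_from_Guess[OF assms(1)])
  show "stack.line_act u (bin [], bin []) = (bin (True # blank N), bin [])"
    using assms(2) stack_act_B[of N "[]" 0] by simp
qed auto

text \<open>The states \<open>Guess\<close> and \<open>Start\<close> are constructors, so this word does not depend on any program.\<close>

definition query :: "nat \<Rightarrow> nat word" where
  "query N = expand (framed Guess (B N @ [d_letter]) Start)"

definition generating_words :: "prog \<Rightarrow> nat word list" where
  "generating_words e = (SOME ws. set ws = (expand \<circ> edge_word) ` edges e)"

lemma set_generating_words: "set (generating_words e) = (expand \<circ> edge_word) ` edges e"
  unfolding generating_words_def by (rule someI_ex) (intro finite_list finite_imageI finite_edges)

theorem query_in_submonoid_iff:
  "(\<exists>u\<in>free_submonoid (set (generating_words e)). query N \<approx> u) \<longleftrightarrow> (N, 0) \<in> sem e"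
proof -
  have concat_expand: "concat (map (expand \<circ> edge_word) es) = expand (concat (map edge_word es))" for es :: "edge list"
    by (induction es) auto
  have "lists (set (generating_words e)) = map (expand \<circ> edge_word) ` lists (edges e)"
    unfolding set_generating_words by (rule lists_image)
  then have "(\<exists>u\<in>free_submonoid (set (generating_words e)). query N \<approx> u) \<longleftrightarrow>
      (\<exists>es. set es \<subseteq> edges e \<and> framed Guess (B N @ [d_letter]) Start \<sim> concat (map edge_word es))"
    by (auto simp: free_submonoid_def query_def line_eqv_def concat_expand lists_eq_set)
  also have "\<dots> \<longleftrightarrow> (N, 0) \<in> sem e"
  proof
    assume "(N, 0) \<in> sem e"
    then show "\<exists>es. set es \<subseteq> edges e \<and>
        framed Guess (B N @ [d_letter]) Start \<sim> concat (map edge_word es)"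
      using accepting_run framed_is_product_if_run by blast
  next
    assume "\<exists>es. set es \<subseteq> edges e \<and>
        framed Guess (B N @ [d_letter]) Start \<sim> concat (map edge_word es)"
    then obtain es where es: "set es \<subseteq> edges e"
      "framed Guess (B N @ [d_letter]) Start \<sim> concat (map edge_word es)" by blast
    from run_if_framed_is_product[OF low_word_edges _ es, of "(0, 0)"]
    show "(N, 0) \<in> sem e" using accepting_run_imp_sem by auto
  qed
  finally show ?thesis .
qed

section \<open>Recursiveness of the query words\<close>

definition total_recursive :: "nat \<Rightarrow> (nat list \<Rightarrow> nat) \<Rightarrow> bool" where
  "total_recursive k F \<longleftrightarrow> (\<exists>f. \<forall>xs. length xs = k \<longrightarrow> rec_eval f xs (F xs))"

lemma total_recursive_proj: "i < k \<Longrightarrow> total_recursive k (\<lambda>xs. xs ! i)"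
  unfolding total_recursive_def by (auto intro: rec_eval.proj)

lemma rec_eval_Comp1: "rec_eval g xs y \<Longrightarrow> rec_eval f [y] z \<Longrightarrow> rec_eval (Comp_rf f [g]) xs z"
  using rec_eval.comp[of "[y]" "[g]" xs f z] by simp

lemma total_recursive_comp1:
  assumes "total_recursive 1 (\<lambda>xs. h (xs ! 0))" "total_recursive k G"
  shows "total_recursive k (\<lambda>xs. h (G xs))"
proof -
  obtain f where f: "\<And>xs. length xs = 1 \<Longrightarrow> rec_eval f xs (h (xs ! 0))"
    using assms(1) unfolding total_recursive_def by blast
  obtain g where g: "\<And>xs. length xs = k \<Longrightarrow> rec_eval g xs (G xs)"
    using assms(2) unfolding total_recursive_def by blast
  have "rec_eval (Comp_rf f [g]) xs (h (G xs))" if "length xs = k" for xs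
    using rec_eval_Comp1[OF g[OF that] f[of "[G xs]"]] by simp
  then show ?thesis unfolding total_recursive_def by blast
qed

lemma total_recursive_comp2:
  assumes "total_recursive 2 (\<lambda>xs. h (xs ! 0) (xs ! 1))" "total_recursive k G1" "total_recursive k G2"
  shows "total_recursive k (\<lambda>xs. h (G1 xs) (G2 xs))"
proof -
  obtain f where f: "\<And>xs. length xs = 2 \<Longrightarrow> rec_eval f xs (h (xs ! 0) (xs ! 1))"
    using assms(1) unfolding total_recursive_def by blast
  obtain g1 where g1: "\<And>xs. length xs = k \<Longrightarrow> rec_eval g1 xs (G1 xs)"
    using assms(2) unfolding total_recursive_def by blast
  obtain g2 where g2: "\<And>xs. length xs = k \<Longrightarrow> rec_eval g2 xs (G2 xs)"
    using assms(3) unfolding total_recursive_def by blast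
  have "rec_eval (Comp_rf f [g1, g2]) xs (h (G1 xs) (G2 xs))" if "length xs = k" for xs
    using g1[OF that] g2[OF that] f[of "[G1 xs, G2 xs]"]
    by (intro rec_eval.comp[of "[G1 xs, G2 xs]"]) (auto simp: less_Suc_eq)
  then show ?thesis unfolding total_recursive_def by blast
qed

lemma total_recursive_Suc: "total_recursive k G \<Longrightarrow> total_recursive k (\<lambda>xs. Suc (G xs))"
proof (rule total_recursive_comp1[where h = Suc])
  have "rec_eval Succ_rf xs (Suc (xs ! 0))" if "length xs = 1" for xs
    using that rec_eval.succ[of "xs ! 0"] by (cases xs) auto
  then show "total_recursive 1 (\<lambda>xs. Suc (xs ! 0))" unfolding total_recursive_def by blast
qed

lemma total_recursive_const: "total_recursive k (\<lambda>xs. c)"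
proof (induction c)
  case 0
  then show ?case unfolding total_recursive_def by (auto intro: rec_eval.zero)
qed (rule total_recursive_Suc)

lemma total_recursive_primrec:
  assumes "total_recursive k F" "total_recursive (Suc (Suc k)) G"
  shows "total_recursive (Suc k) (\<lambda>xs. rec_nat (F (tl xs)) (\<lambda>n r. G (n # r # tl xs)) (xs ! 0))"
proof -
  obtain f where f: "\<And>xs. length xs = k \<Longrightarrow> rec_eval f xs (F xs)"
    using assms(1) unfolding total_recursive_def by blast
  obtain g where g: "\<And>xs. length xs = Suc (Suc k) \<Longrightarrow> rec_eval g xs (G xs)"
    using assms(2) unfolding total_recursive_def by blast
  have "rec_eval (Primrec_rf f g) (n # xs) (rec_nat (F xs) (\<lambda>n r. G (n # r # xs)) n)"
    if "length xs = k" for n xs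
    by (induction n) (use f[OF that] g that in \<open>auto intro: rec_eval.primrec_0 rec_eval.primrec_Suc\<close>)
  then have "rec_eval (Primrec_rf f g) xs (rec_nat (F (tl xs)) (\<lambda>n r. G (n # r # tl xs)) (xs ! 0))"
    if "length xs = Suc k" for xs
    using that by (cases xs) auto
  then show ?thesis unfolding total_recursive_def by blast
qed

lemma total_recursive_recursion:
  assumes G: "total_recursive 2 (\<lambda>xs. g (xs ! 0) (xs ! 1))"
    and h: "h 0 = c" "\<And>n. h (Suc n) = g n (h n)"
  shows "total_recursive 1 (\<lambda>xs. h (xs ! 0))"
proof -
  have "h n = rec_nat c g n" for n using h by (induction n) auto
  then show ?thesis
    using total_recursive_primrec[OF total_recursive_const[of 0 c], of "\<lambda>xs. g (xs ! 0) (xs ! 1)"] G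
    by (simp add: numeral_2_eq_2)
qed

lemma total_recursive_add: "total_recursive k F \<Longrightarrow> total_recursive k G \<Longrightarrow>
  total_recursive k (\<lambda>xs. F xs + G xs)"
proof (rule total_recursive_comp2[where h = "(+)"])
  have eq: "rec_nat x (\<lambda>n. Suc) n = n + x" for n x :: nat by (induction n) auto
  have "total_recursive (Suc 1) (\<lambda>xs. rec_nat (tl xs ! 0) (\<lambda>n r. Suc ((n # r # tl xs) ! 1)) (xs ! 0))"
    by (rule total_recursive_primrec[of 1 "\<lambda>xs. xs ! 0" "\<lambda>xs. Suc (xs ! 1)"])
      (auto intro!: total_recursive_proj total_recursive_Suc)
  then obtain f where f: "\<And>xs. length xs = 2 \<Longrightarrow> rec_eval f xs (xs ! 0 + tl xs ! 0)"
    unfolding total_recursive_def by (auto simp: eq numeral_2_eq_2)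
  have "rec_eval f xs (xs ! 0 + xs ! 1)" if "length xs = 2" for xs
    using f[OF that] that by (simp add: nth_tl)
  then show "total_recursive 2 (\<lambda>xs. xs ! 0 + xs ! 1)" unfolding total_recursive_def by blast
qed

lemma total_recursive_prod_encode:
  assumes "total_recursive k F" "total_recursive k G"
  shows "total_recursive k (\<lambda>xs. prod_encode (F xs, G xs))"
proof -
  have triangle: "total_recursive 1 (\<lambda>xs. triangle (xs ! 0))"
    by (rule total_recursive_recursion[where h = triangle and g = "\<lambda>n r. r + Suc n"])
      (auto intro!: total_recursive_add total_recursive_Suc total_recursive_proj)
  then have "total_recursive k (\<lambda>xs. triangle (F xs + G xs) + F xs)"
    by (intro total_recursive_add total_recursive_comp1[OF triangle] assms)
  then show ?thesis by (simp add: prod_encode_def)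
qed

lemma total_recursive_power2: "total_recursive 1 (\<lambda>xs. 2 ^ (xs ! 0))"
  by (rule total_recursive_recursion[where h = "\<lambda>n. 2 ^ n" and g = "\<lambda>n r. r + r"])
    (auto intro!: total_recursive_add total_recursive_proj)

lemma total_recursive_list_encode_replicate:
  assumes "total_recursive k F"
  shows "total_recursive k (\<lambda>xs. list_encode (us @ replicate (F xs) c @ vs))"
proof (induction us)
  case Nil
  have "total_recursive 1 (\<lambda>xs. list_encode (replicate (xs ! 0) c @ vs))"
    by (rule total_recursive_recursion[where h = "\<lambda>n. list_encode (replicate n c @ vs)"
          and g = "\<lambda>n r. Suc (prod_encode (c, r))"])
      (auto intro!: total_recursive_Suc total_recursive_prod_encode total_recursive_const
        total_recursive_proj)
  then show ?case using total_recursive_comp1[OF _ assms, of "\<lambda>n. list_encode (replicate n c @ vs)"] by simp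
next
  case (Cons u us)
  then show ?case
    by (auto intro!: total_recursive_Suc total_recursive_prod_encode total_recursive_const)
qed

lemma query_eq: "\<exists>us vs. \<forall>N. query N = us @ replicate N (Inl 0) @ vs"
proof -
  have "expand (B N) = replicate N (Inl 0)" for N
    by (induction N) (auto simp: expand_letter_def tpow_def)
  then show ?thesis
    by (intro exI[of _ "expand_letter (state_index Guess, True)"]
        exI[of _ "expand_letter d_letter @ expand_letter (state_index Start, False)"])
      (simp add: query_def framed_def)
qed

text \<open>The conjugate \<open>b\<close> with index 0 is the generator \<open>a\<close> itself, so the query for \<open>N\<close> is the \<open>N\<close>-th power of a single
  letter between two constant words.\<close>

lemma total_recursive_query:
  assumes "total_recursive k F"
  shows "total_recursive k (\<lambda>xs. word_encode (query (F xs)))"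
proof -
  obtain us vs where eq: "\<And>N. query N = us @ replicate N (Inl 0) @ vs" using query_eq by blast
  have "total_recursive k (\<lambda>xs. list_encode (map sum_encode us @
      replicate (F xs) (sum_encode (Inl 0)) @ map sum_encode vs))"
    by (rule total_recursive_list_encode_replicate[OF assms])
  then show ?thesis by (simp add: eq word_encode_def)
qed

section \<open>Diagonalization\<close>

abbreviation group_G :: "nat word set monoid" where
  "group_G \<equiv> Gp gens {(commutator_word, [])}"

abbreviation gen_G :: "nat \<Rightarrow> nat word set" where
  "gen_G \<equiv> Gp_gen gens {(commutator_word, [])}"

lemma word_val_eq_iff:
  assumes "u \<in> words gens" "v \<in> words gens"
  shows "word_val group_G gen_G u = word_val group_G gen_G v \<longleftrightarrow> u \<approx> v"
  using assms by (simp add: word_val_Gp pres_class_eq_iff eqv_def)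

lemma free_submonoid_in_words: "set ws \<subseteq> words A \<Longrightarrow> free_submonoid (set ws) \<subseteq> words A"
proof -
  assume ws: "set ws \<subseteq> words A"
  have "set us \<subseteq> words A \<Longrightarrow> concat us \<in> words A" for us by (induction us) auto
  then show ?thesis using ws by (auto simp: free_submonoid_def)
qed

lemma generating_words_in_words: "set (generating_words e) \<subseteq> words gens"
  unfolding set_generating_words by auto

lemma smp_positive_iff:
  "(generating_words e, query N) \<in> smp_positive group_G gens gen_G \<longleftrightarrow> (N, 0) \<in> sem e"
proof -
  have q: "query N \<in> words gens" by (simp add: query_def)
  have u: "u \<in> words gens" if "u \<in> free_submonoid (set (generating_words e))" for u
    using that free_submonoid_in_words[OF generating_words_in_words] by blast
  have "(generating_words e, query N) \<in> smp_positive group_G gens gen_G \<longleftrightarrow>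
      (\<exists>u\<in>free_submonoid (set (generating_words e)). query N \<approx> u)"
    using q u generating_words_in_words[of e]
    by (auto simp: smp_positive_def smp_instances_def word_val_eq_iff image_iff)
  then show ?thesis using query_in_submonoid_iff by simp
qed

text \<open>From a decision procedure \<open>d\<close> one gets a function \<open>f\<close> that halts on \<open>x\<close> iff \<open>d\<close> says that the query for
  \<open>2\<^sup>x\<close> is not in the submonoid generated by the words with code \<open>x\<close>. For the words that belong to the program of
  \<open>f\<close>, and \<open>x\<close> their code, the query is in the submonoid iff \<open>f\<close> halts on \<open>x\<close>. No universal
  machine is needed, since the generating words are part of the input.\<close>

theorem undecidable_membership: "\<not> decidable_submonoid_membership group_G gens gen_G"
proof
  assume "decidable_submonoid_membership group_G gens gen_G"
  then obtain d where d: "\<And>x. x \<in> smp_instances gens \<Longrightarrow>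
      rec_eval d [smp_encode x] (if x \<in> smp_positive group_G gens gen_G then 1 else 0)"
    unfolding decidable_submonoid_membership_def decidable_on_def by blast
  have "total_recursive 2 (\<lambda>xs. prod_encode (xs ! 1, word_encode (query (2 ^ (xs ! 1)))))"
    by (intro total_recursive_prod_encode total_recursive_query
        total_recursive_comp1[OF total_recursive_power2] total_recursive_proj) simp_all
  then obtain h where "\<And>xs. length xs = 2 \<Longrightarrow>
      rec_eval h xs (prod_encode (xs ! 1, word_encode (query (2 ^ (xs ! 1)))))"
    unfolding total_recursive_def by blast
  from this[of "[_, _]"] have h: "rec_eval h [m, x] (prod_encode (x, word_encode (query (2 ^ x))))"
    for m x by simp
  \<comment> \<open>The value searched for is ignored by \<open>h\<close>: the search stops at once or never.\<close>
  define f where "f = Mu_rf (Comp_rf d [h])"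
  obtain e where e: "\<And>x. (2 ^ x, 0) \<in> sem e \<longleftrightarrow> (\<exists>y. rec_eval f [x] y)"
    using halting_program by blast
  define ws where "ws = generating_words e"
  define x where "x = list_encode (map word_encode ws)"
  define P where "P \<longleftrightarrow> (ws, query (2 ^ x)) \<in> smp_positive group_G gens gen_G"
  have inst: "(ws, query (2 ^ x)) \<in> smp_instances gens"
    using generating_words_in_words[of e] by (auto simp: smp_instances_def ws_def query_def)
  have enc: "smp_encode (ws, query (2 ^ x)) = prod_encode (x, word_encode (query (2 ^ x)))"
    by (simp add: smp_encode_def x_def)
  have "rec_eval d [prod_encode (x, word_encode (query (2 ^ x)))] (if P then 1 else 0)"
    using d[OF inst] unfolding enc P_def .
  then have run: "rec_eval (Comp_rf d [h]) [m, x] (if P then 1 else 0)" for m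
    by (rule rec_eval_Comp1[OF h])
  have "P \<longleftrightarrow> (\<exists>y. rec_eval f [x] y)"
    unfolding P_def ws_def smp_positive_iff e ..
  also have "\<dots> \<longleftrightarrow> \<not> P"
  proof
    assume "\<exists>y. rec_eval f [x] y"
    then obtain y where "rec_eval (Comp_rf d [h]) [y, x] 0"
      unfolding f_def by (auto elim: rec_eval.cases)
    then show "\<not> P" using rec_eval_deterministic[OF run] by fastforce
  next
    assume "\<not> P"
    then have "rec_eval f [x] 0" unfolding f_def using run[of 0] by (intro rec_eval.mu) auto
    then show "\<exists>y. rec_eval f [x] y" ..
  qed
  finally show False by simp
qed

theorem theoremB:
  shows "\<exists>(A :: nat set) (w :: nat word).
    finite A \<and> w \<in> words A \<and>
    \<not> decidable_submonoid_membership (Gp A {(w, [])}) A (Gp_gen A {(w, [])})"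
proof (intro exI conjI)
  show "finite gens" by (simp add: gens_def)
  show "commutator_word \<in> words gens" by (simp add: commutator_word_def)
qed (rule undecidable_membership)

end
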